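(* Let $\mathcal{H}$ be a complex Hilbert space, let $r$ be a positive rational number such that $r>1$, and let $\phi:\mathcal{B}(\mathcal{H})\to\mathcal{B}(\mathcal{H})$ be a surjective function (not assumed linear or continuous) which satisfies $$\sigma\big(|A|^r B\big)=\sigma\big(|\phi(A)|^r\phi(B)\big)$$ for all $A,B\in\mathcal{B}(\mathcal{H})$. Then there exists a bounded linear or conjugate linear bijection $T:\mathcal{H}\to\mathcal{H}$ satisfying $T^*=T^{-1}$ such that $$\phi(A)=TAT^*\quad\text{for all }A\in\mathcal{B}(\mathcal{H}).$$
   Context: $\mathcal{B}(\mathcal{H})$ is the space of all bounded linear operators on $\mathcal{H}$, $\sigma(A)$ is the spectrum of $A\in\mathcal{B}(\mathcal{H})$, and $|A|=(A^*A)^{1/2}$. For a positive rational number $r$, $|A|^r$ is defined by the continuous functional calculus. For a conjugate linear bounded $T$, the adjoint $T^*$ is the conjugate linear map determined by $\langle Tx,y\rangle=\langle T^*y,x\rangle$ for all $x,y$; thus the conclusion says that $T$ is unitary or antiunitary. *)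

theory Defs
  imports "HOL-Analysis.Analysis" "HOL-Computational_Algebra.Polynomial"
begin

(* A complex Hilbert space is given over the library's real inner product spaces: the real
   scalar multiplication is the restriction of the complex one and the real inner product is
   the real part of the complex one.  The library norm is then sqrt (cinner x x), and positive
   definiteness and additivity in the second argument follow.  The complex inner product is
   linear in its first argument and conjugate linear in its second. *)

class complex_inner = real_inner +
  fixes scaleC :: "complex \<Rightarrow> 'a \<Rightarrow> 'a" (infixr \<open>*\<^sub>C\<close> 75)
    and cinner :: "'a \<Rightarrow> 'a \<Rightarrow> complex"
  assumes scaleC_add_right: "c *\<^sub>C (x + y) = c *\<^sub>C x + c *\<^sub>C y"
    and scaleC_add_left: "(c + d) *\<^sub>C x = c *\<^sub>C x + d *\<^sub>C x"
    and scaleC_scaleC: "c *\<^sub>C d *\<^sub>C x = (c * d) *\<^sub>C x"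
    and scaleC_of_real: "complex_of_real t *\<^sub>C x = t *\<^sub>R x"
    and cinner_commute: "cinner x y = cnj (cinner y x)"
    and cinner_add_left: "cinner (x + y) z = cinner x z + cinner y z"
    and cinner_scaleC_left: "cinner (c *\<^sub>C x) y = c * cinner x y"
    and Re_cinner: "Re (cinner x y) = inner x y"

class chilbert_space = complex_inner + complete_space

lemma cinner_self: "cinner x x = complex_of_real ((norm x)\<^sup>2)"
  for x :: "'a::complex_inner"
proof -
  have "cinner x x \<in> \<real>"
    by (metis Reals_cnj_iff cinner_commute)
  then show ?thesis
    by (simp add: complex_is_Real_iff complex_eq_iff Re_cinner power2_norm_eq_inner)
qed

definition bounded_clinear :: "('a::complex_inner \<Rightarrow> 'a) \<Rightarrow> bool"
  where "bounded_clinear A \<longleftrightarrow> bounded_linear A \<and> (\<forall>c x. A (c *\<^sub>C x) = c *\<^sub>C A x)"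

definition bounded_antilinear :: "('a::complex_inner \<Rightarrow> 'a) \<Rightarrow> bool"
  where "bounded_antilinear T \<longleftrightarrow> bounded_linear T \<and> (\<forall>c x. T (c *\<^sub>C x) = cnj c *\<^sub>C T x)"

definition bounded_ops :: "('a::complex_inner \<Rightarrow> 'a) set"
  where "bounded_ops = {A. bounded_clinear A}"

definition cadjoint :: "('a::chilbert_space \<Rightarrow> 'a) \<Rightarrow> ('a \<Rightarrow> 'a)"
  where "cadjoint A = (THE B. bounded_clinear B \<and> (\<forall>x y. cinner (A x) y = cinner x (B y)))"

definition antilinear_adjoint :: "('a::chilbert_space \<Rightarrow> 'a) \<Rightarrow> ('a \<Rightarrow> 'a)"
  where "antilinear_adjoint T =
    (THE S. bounded_antilinear S \<and> (\<forall>x y. cinner (T x) y = cinner (S y) x))"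

definition spectrum :: "('a::complex_inner \<Rightarrow> 'a) \<Rightarrow> complex set"
  where "spectrum A =
    {z. \<not> (\<exists>B\<in>bounded_ops. (\<lambda>x. A x - z *\<^sub>C x) \<circ> B = id \<and> B \<circ> (\<lambda>x. A x - z *\<^sub>C x) = id)}"

definition poly_op :: "real poly \<Rightarrow> ('a::real_vector \<Rightarrow> 'a) \<Rightarrow> ('a \<Rightarrow> 'a)"
  where "poly_op p A = (\<lambda>x. \<Sum>i\<le>degree p. coeff p i *\<^sub>R (A ^^ i) x)"

(* Continuous functional calculus of a self-adjoint operator A, for real functions f that are
   continuous on the (real) spectrum of A: f(A) is the operator norm limit of p_n(A) for
   polynomials p_n converging to f uniformly on the spectrum. *)

definition cfc :: "(real \<Rightarrow> real) \<Rightarrow> ('a::chilbert_space \<Rightarrow> 'a) \<Rightarrow> ('a \<Rightarrow> 'a)"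
  where "cfc f A = (THE X. X \<in> bounded_ops \<and>
    (\<exists>p. uniform_limit {t. complex_of_real t \<in> spectrum A} (\<lambda>n. poly (p n)) f sequentially \<and>
         (\<lambda>n. onorm (\<lambda>x. poly_op (p n) A x - X x)) \<longlonglongrightarrow> 0))"

definition abs_op :: "('a::chilbert_space \<Rightarrow> 'a) \<Rightarrow> ('a \<Rightarrow> 'a)"
  where "abs_op A = cfc sqrt (cadjoint A \<circ> A)"

definition abs_op_power :: "('a::chilbert_space \<Rightarrow> 'a) \<Rightarrow> real \<Rightarrow> ('a \<Rightarrow> 'a)"
  where "abs_op_power A s = cfc (\<lambda>t. t powr s) (abs_op A)"

end

theory Submission
  imports Defs "HOL-Computational_Algebra.Fundamental_Theorem_Algebra"
begin

text \<open>
  Write \<open>u \<otimes> x\<close> for the operator \<open>v \<mapsto> \<langle>v, x\<rangle> u\<close>.  For a unit vector \<open>x\<close> one has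
  \<open>\<bar>u \<otimes> x\<bar>\<^sup>r = \<parallel>u\<parallel>\<^sup>r (x \<otimes> x)\<close>, so the spectrum of \<open>\<bar>u \<otimes> x\<bar>\<^sup>r B\<close> is
  \<open>\<parallel>u\<parallel>\<^sup>r \<langle>B x, x\<rangle>\<close> up to the point \<open>0\<close>.  Conversely, if the spectra of \<open>\<bar>A\<bar>\<^sup>r B\<close> never contain two
  different nonzero points, then \<open>A\<close> has rank at most one.  Hence \<open>\<phi>\<close> maps \<open>u \<otimes> x\<close> to some
  \<open>w \<otimes> y\<close> with \<open>\<parallel>u\<parallel>\<^sup>r \<langle>B x, x\<rangle> = \<parallel>w\<parallel>\<^sup>r \<langle>\<phi> B y, y\<rangle>\<close> for all \<open>B\<close>, and every unit vector \<open>y\<close>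
  arises in this way.  Therefore \<open>\<phi>\<close> is complex linear and preserves positivity; homogeneity of degree
  \<open>r + 1\<close> then forces \<open>\<phi> (x \<otimes> x) = y \<otimes> y\<close> with \<open>y\<close> a unit vector and \<open>\<langle>B x, x\<rangle> = \<langle>\<phi> B y, y\<rangle>\<close>.

  Fix a unit vector \<open>e\<close> with \<open>\<phi> (e \<otimes> e) = f \<otimes> f\<close>.  The second leg of \<open>\<phi> (u \<otimes> e)\<close> can only be a
  multiple of \<open>f\<close>, so \<open>\<phi> (u \<otimes> e) = T u \<otimes> f\<close> with \<open>T\<close> linear, isometric and surjective.  Evaluating
  the quadratic forms of \<open>u \<otimes> e\<close> shows that \<open>v\<close> corresponds to a multiple of \<open>T v\<close> whenever
  \<open>\<langle>v, e\<rangle> \<noteq> 0\<close>, and this determines \<open>\<phi> B = T B T\<^sup>*\<close>.  In particular \<open>T\<close> is always unitary: the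
  antiunitary alternative would make \<open>\<phi>\<close> conjugate linear.
\<close>

section \<open>Complex inner product spaces\<close>

interpretation complex_vector: vector_space "scaleC :: complex \<Rightarrow> 'a \<Rightarrow> 'a::complex_inner"
proof
  show "1 *\<^sub>C x = x" for x :: 'a
    using scaleC_of_real[of 1 x] by simp
qed (auto simp: scaleC_add_right scaleC_add_left scaleC_scaleC)

lemma cinner_add_right: "cinner x (y + z) = cinner x y + cinner x z"
  by (metis cinner_commute cinner_add_left complex_cnj_add)

lemma cinner_scaleC_right: "cinner x (c *\<^sub>C y) = cnj c * cinner x y"
  by (metis cinner_commute cinner_scaleC_left complex_cnj_mult)

lemma cinner_zero_left [simp]: "cinner 0 x = 0"
  using cinner_add_left[of 0 0 x] by simp

lemma cinner_zero_right [simp]: "cinner x 0 = 0"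
  using cinner_add_right[of x 0 0] by simp

lemma cinner_minus_left: "cinner (- x) y = - cinner x y"
  using cinner_add_left[of x "- x" y] by (simp add: add_eq_0_iff)

lemma cinner_minus_right: "cinner x (- y) = - cinner x y"
  using cinner_add_right[of x y "- y"] by (simp add: add_eq_0_iff)

lemma cinner_diff_left: "cinner (x - y) z = cinner x z - cinner y z"
  using cinner_add_left[of x "- y" z] by (simp add: cinner_minus_left)

lemma cinner_diff_right: "cinner x (y - z) = cinner x y - cinner x z"
  using cinner_add_right[of x y "- z"] by (simp add: cinner_minus_right)

lemma cinner_scaleR_left: "cinner (t *\<^sub>R x) y = of_real t * cinner x y"
  by (metis scaleC_of_real cinner_scaleC_left)

lemma cinner_scaleR_right: "cinner x (t *\<^sub>R y) = of_real t * cinner x y"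
  by (metis scaleC_of_real cinner_scaleC_right complex_cnj_complex_of_real)

lemmas cinner_simps = cinner_add_left cinner_add_right cinner_diff_left cinner_diff_right
  cinner_minus_left cinner_minus_right cinner_scaleC_left cinner_scaleC_right
  cinner_scaleR_left cinner_scaleR_right

lemma cinner_eq_zero_iff: "cinner x x = 0 \<longleftrightarrow> x = 0"
  by (simp add: cinner_self)

lemma cinner_ext: "(\<And>z. cinner z x = cinner z y) \<Longrightarrow> x = y"
  by (metis cinner_diff_right cinner_eq_zero_iff eq_iff_diff_eq_0)

lemma norm_scaleC [simp]: "norm (c *\<^sub>C x) = cmod c * norm (x::'a::complex_inner)"
proof -
  have "complex_of_real ((norm (c *\<^sub>C x))\<^sup>2) = of_real ((cmod c * norm x)\<^sup>2)"
    unfolding cinner_self[symmetric] cinner_simps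
    using complex_norm_square[of c] by (simp add: cinner_self power_mult_distrib)
  then have "(norm (c *\<^sub>C x))\<^sup>2 = (cmod c * norm x)\<^sup>2"
    using of_real_eq_iff by blast
  then show ?thesis
    by simp
qed

lemma cinner_Cauchy_Schwarz: "cmod (cinner x y) \<le> norm x * norm (y::'a::complex_inner)"
proof (cases "cinner x y = 0")
  case False
  \<comment> \<open>The phase \<open>c\<close> turns \<open>cinner x y\<close> into its modulus, so
    the real inequality for \<open>inner\<close>, applied to \<open>c *\<^sub>C x\<close>, gives the
    complex one.\<close>
  define c where "c = cnj (sgn (cinner x y))"
  have "c * cinner x y = of_real (cmod (cinner x y))"
    using False by (simp add: c_def sgn_eq mult.commute complex_norm_square[symmetric] power2_eq_square)
  moreover have "cmod c = 1"
    using False by (simp add: c_def norm_sgn)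
  ultimately show ?thesis
    using norm_cauchy_schwarz[of "c *\<^sub>C x" y]
    by (simp add: cinner_scaleC_left flip: Re_cinner)
qed auto

lemma Re_cinner_self: "Re (cinner x x) = (norm x)\<^sup>2"
  by (simp add: cinner_self)

text \<open>Equality case of Cauchy-Schwarz: the component of \<open>x\<close> orthogonal to
  \<open>y\<close> has squared norm one minus the squared modulus of
  \<open>cinner x y\<close>.\<close>

lemma scaleC_unit_if_cinner_eq_1:
  assumes "norm x = 1" "norm y = 1" "cmod (cinner x y) = 1"
  shows "x = cinner x y *\<^sub>C y"
proof -
  define c where "c = cinner x y"
  have "cinner (x - c *\<^sub>C y) (x - c *\<^sub>C y) = 1 - c * cnj c"
    unfolding cinner_simps using assms cinner_commute[of y x]
    by (simp add: cinner_self c_def algebra_simps)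
  also have "\<dots> = 0"
    using assms(3) by (simp add: c_def complex_norm_square[symmetric])
  finally show ?thesis
    unfolding c_def by (simp add: cinner_eq_zero_iff)
qed

lemma normalize_scaleC:
  assumes "x \<noteq> (0::'a::complex_inner)"
  obtains e where "norm e = 1" "x = complex_of_real (norm x) *\<^sub>C e"
  using assms by (intro that[of "(1 / norm x) *\<^sub>R x"]) (auto simp: scaleC_of_real)

section \<open>Bounded operators\<close>

lemma bounded_clinearI:
  assumes "\<And>x y. A (x + y) = A x + A y" "\<And>c x. A (c *\<^sub>C x) = c *\<^sub>C A x" "\<And>x. norm (A x) \<le> norm x * K"
  shows "bounded_clinear A"
  unfolding bounded_clinear_def
  by (intro conjI bounded_linear_intro[of _ K]) (use assms in \<open>auto simp flip: scaleC_of_real\<close>)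

lemma bounded_clinear_bounded_linear: "bounded_clinear A \<Longrightarrow> bounded_linear A"
  and bounded_clinear_scaleC: "bounded_clinear A \<Longrightarrow> A (c *\<^sub>C x) = c *\<^sub>C A x"
  by (auto simp: bounded_clinear_def)

lemma bounded_clinear_add_apply: "bounded_clinear A \<Longrightarrow> A (x + y) = A x + A y"
  and bounded_clinear_diff_apply: "bounded_clinear A \<Longrightarrow> A (x - y) = A x - A y"
  and bounded_clinear_minus_apply: "bounded_clinear A \<Longrightarrow> A (- x) = - A x"
  and bounded_clinear_scaleR: "bounded_clinear A \<Longrightarrow> A (t *\<^sub>R x) = t *\<^sub>R A x"
  and bounded_clinear_zero: "bounded_clinear A \<Longrightarrow> A 0 = 0"
  by (simp_all add: linear_simps[OF bounded_clinear_bounded_linear] bounded_clinear_scaleC)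

lemmas bounded_clinear_apply = bounded_clinear_add_apply bounded_clinear_diff_apply
  bounded_clinear_minus_apply bounded_clinear_scaleR bounded_clinear_zero bounded_clinear_scaleC

lemma bounded_clinear_onorm: "bounded_clinear A \<Longrightarrow> norm (A x) \<le> onorm A * norm x"
  by (simp add: bounded_clinear_bounded_linear onorm)

lemma bounded_clinear_id [simp]: "bounded_clinear (\<lambda>x. x)"
  by (simp add: bounded_clinear_def)

lemma bounded_clinear_compose:
    "bounded_clinear A \<Longrightarrow> bounded_clinear B \<Longrightarrow> bounded_clinear (\<lambda>x. A (B x))"
  using bounded_linear_compose[of A B] by (simp add: bounded_clinear_def)

lemma bounded_clinear_add:
    "bounded_clinear A \<Longrightarrow> bounded_clinear B \<Longrightarrow> bounded_clinear (\<lambda>x. A x + B x)"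
  and bounded_clinear_diff:
    "bounded_clinear A \<Longrightarrow> bounded_clinear B \<Longrightarrow> bounded_clinear (\<lambda>x. A x - B x)"
  by (simp_all add: bounded_clinear_def bounded_linear_add bounded_linear_sub
      scaleC_add_right complex_vector.scale_right_diff_distrib)

lemma bounded_clinear_zero_op: "bounded_clinear (\<lambda>x. 0)"
  by (simp add: bounded_clinear_def)

lemma bounded_clinear_scaleC_op:
  assumes "bounded_clinear A"
  shows "bounded_clinear (\<lambda>x. c *\<^sub>C A x)"
proof (rule bounded_clinearI)
  show "norm (c *\<^sub>C A x) \<le> norm x * (cmod c * onorm A)" for x
    using mult_left_mono[OF bounded_clinear_onorm[OF assms, of x], of "cmod c"]
    by (simp add: ac_simps)
qed (use assms in \<open>auto simp: bounded_clinear_apply scaleC_add_right mult.commute\<close>)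

lemma bounded_clinear_scaleR_op:
  "bounded_clinear A \<Longrightarrow> bounded_clinear (\<lambda>x. t *\<^sub>R A x)"
  using bounded_clinear_scaleC_op[of A "of_real t"] by (simp add: scaleC_of_real)

text \<open>The operator \<open>u \<otimes> x\<close> of the overview; it depends linearly on
  \<open>u\<close> and conjugate linearly on \<open>x\<close>.\<close>

definition rank1 :: "'a::complex_inner \<Rightarrow> 'a \<Rightarrow> 'a \<Rightarrow> 'a"
  where "rank1 u x = (\<lambda>v. cinner v x *\<^sub>C u)"

lemma bounded_clinear_rank1 [simp]: "bounded_clinear (rank1 u x)"
proof (rule bounded_clinearI)
  show "norm (rank1 u x v) \<le> norm v * (norm x * norm u)" for v
    using mult_right_mono[OF cinner_Cauchy_Schwarz[of v x], of "norm u"]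
    by (simp add: rank1_def ac_simps)
qed (auto simp: rank1_def cinner_simps scaleC_add_left)

lemma mem_bounded_ops: "A \<in> bounded_ops \<longleftrightarrow> bounded_clinear A"
  by (simp add: bounded_ops_def)

lemma bounded_clinear_inv:
  assumes A: "bounded_clinear A" and "bij A" and "c > 0" and bound: "\<And>x. c * norm x \<le> norm (A x)"
  shows "bounded_clinear (inv A)"
proof (rule bounded_clinearI)
  have Ai: "A (inv A x) = x" for x
    using \<open>bij A\<close> by (simp add: bij_is_surj surj_f_inv_f)
  have eqI: "x = y" if "A x = A y" for x y
    using that \<open>bij A\<close> by (simp add: bij_is_inj inj_eq)
  show "inv A (x + y) = inv A x + inv A y" "inv A (c *\<^sub>C x) = c *\<^sub>C inv A x" for x y c
    by (rule eqI; simp add: Ai bounded_clinear_apply[OF A])+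
  show "norm (inv A x) \<le> norm x * (1 / c)" for x
    using bound[of "inv A x"] \<open>c > 0\<close> by (simp add: Ai field_simps)
qed

text \<open>Complex polarization: replacing \<open>y\<close> by \<open>\<i> *\<^sub>C y\<close>
  flips the relative sign of the two cross terms, so both vanish.\<close>

lemma op_eq_zero_if_cinner_zero:
  assumes D: "bounded_clinear D" and q: "\<And>x. cinner (D x) x = 0"
  shows "D x = 0"
proof -
  have 1: "cinner (D x) y + cinner (D y) x = 0" for x y
    using q[of "x + y"] q[of x] q[of y]
    by (simp add: cinner_simps bounded_clinear_apply[OF D] add.commute)
  have "cinner (D x) y = 0" for y
    using 1[of x y] 1[of x "\<i> *\<^sub>C y"]
    by (simp add: cinner_simps bounded_clinear_apply[OF D] complex_eq_iff)
  then show ?thesis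
    using cinner_eq_zero_iff by blast
qed

lemma op_eq_if_cinner_eq:
  assumes "bounded_clinear A" "bounded_clinear B"
    and q: "\<And>x. norm x = 1 \<Longrightarrow> cinner (A x) x = cinner (B x) x"
  shows "A = B"
proof
  fix v
  have "cinner (A x) x = cinner (B x) x" for x
  proof (cases "x = 0")
    case False
    then obtain e where e: "norm e = 1" and x: "x = complex_of_real (norm x) *\<^sub>C e"
      by (rule normalize_scaleC)
    have "A x = complex_of_real (norm x) *\<^sub>C A e" "B x = complex_of_real (norm x) *\<^sub>C B e"
      using x assms(1,2) by (metis bounded_clinear_scaleC)+
    then show ?thesis
      using q[OF e] by (subst (2 4) x) (simp add: cinner_simps)
  qed (use assms in \<open>simp add: bounded_clinear_apply\<close>)
  then show "A v = B v"
    using op_eq_zero_if_cinner_zero[of "\<lambda>x. A x - B x" v] assms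
    by (simp add: bounded_clinear_diff cinner_simps)
qed

section \<open>Riesz representation and adjoints\<close>

text \<open>Up to a constant, \<open>J\<close> is the squared distance to the representing vector,
  which is therefore sought as its minimizer. The parallelogram law makes a minimizing sequence
  Cauchy.\<close>

lemma riesz_representation:
  fixes f :: "'a::{real_inner,complete_space} \<Rightarrow> real"
  assumes f: "bounded_linear f"
  obtains y where "\<And>x. f x = inner x y"
proof -
  interpret f: bounded_linear f by fact
  define J where "J x = (norm x)\<^sup>2 - 2 * f x" for x
  obtain K where K: "\<And>x. norm (f x) \<le> norm x * K"
    using f.bounded by blast
  have J_ge: "- K\<^sup>2 \<le> J x" for x
  proof -
    have "0 \<le> (norm x - K)\<^sup>2"
      by simp
    then show ?thesis
      using K[of x] by (simp add: J_def power2_eq_square algebra_simps abs_le_iff)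
  qed
  define m where "m = Inf (range J)"
  have bdd: "bdd_below (range J)"
    using J_ge by (auto intro!: bdd_belowI)
  have m_le: "m \<le> J x" for x
    unfolding m_def by (rule cInf_lower[OF _ bdd]) auto
  have parallelogram: "(norm (x - y))\<^sup>2 \<le> 2 * (J x + J y) - 4 * m" for x y
  proof -
    have "(norm (x - y))\<^sup>2 = 2 * (J x + J y) - 4 * J ((1/2) *\<^sub>R (x + y))"
      unfolding J_def power2_norm_eq_inner
      by (simp add: f.scaleR f.add inner_commute algebra_simps)
    then show ?thesis
      using m_le[of "(1/2) *\<^sub>R (x + y)"] by linarith
  qed
  have "\<exists>x. J x < m + 1 / Suc n" for n
    using cInf_lessD[of "range J" "m + 1 / Suc n"] by (auto simp: m_def)
  then obtain s where s: "\<And>n. J (s n) < m + 1 / Suc n"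
    by metis
  have "Cauchy s"
  proof (rule metric_CauchyI)
    fix e :: real assume "e > 0"
    then obtain N where N: "inverse (real (Suc N)) < e\<^sup>2 / 4"
      using reals_Archimedean[of "e\<^sup>2 / 4"] by auto
    have "dist (s i) (s j) < e" if "i \<ge> N" "j \<ge> N" for i j
    proof -
      have J_less: "J (s i) < m + e\<^sup>2 / 4" if "i \<ge> N" for i
      proof -
        have "1 / Suc i \<le> inverse (real (Suc N))"
          using that by (simp add: field_simps)
        then show ?thesis
          using s[of i] N by linarith
      qed
      have "(norm (s i - s j))\<^sup>2 < e\<^sup>2"
        using parallelogram[of "s i" "s j"] add_strict_mono[OF J_less[OF that(1)] J_less[OF that(2)]]
        by (simp add: field_simps)
      then show ?thesis
        using \<open>e > 0\<close> by (simp add: dist_norm power2_less_imp_less)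
    qed
    then show "\<exists>M. \<forall>i\<ge>M. \<forall>j\<ge>M. dist (s i) (s j) < e"
      by blast
  qed
  then obtain y where y: "s \<longlonglongrightarrow> y"
    using Cauchy_convergent convergent_def by blast
  have "(\<lambda>n. J (s n)) \<longlonglongrightarrow> J y"
    unfolding J_def by (intro tendsto_intros f.tendsto y)
  moreover have "(\<lambda>n. m + 1 / Suc n) \<longlonglongrightarrow> m + 0"
    by (intro tendsto_intros) (use LIMSEQ_inverse_real_of_nat in \<open>simp add: inverse_eq_divide\<close>)
  ultimately have Jy: "J y \<le> m + 0"
    by (rule LIMSEQ_le) (use s in \<open>auto intro: less_imp_le\<close>)
  have "f x = inner x y" for x
  proof (cases "x = 0")
    case False
    define d where "d = f x - inner x y"
    \<comment> \<open>This \<open>t\<close> minimizes \<open>J\<close> on the line through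
      \<open>y\<close> in direction \<open>x\<close>; minimality of \<open>J y\<close> then forces
      the defect \<open>d\<close> to vanish.\<close>
    define t where "t = d / (norm x)\<^sup>2"
    have "J (y + t *\<^sub>R x) = J y - 2 * t * d + t\<^sup>2 * (norm x)\<^sup>2"
      unfolding J_def d_def power2_norm_eq_inner
      by (simp add: f.scaleR f.add inner_commute algebra_simps power2_eq_square)
    also have "\<dots> = J y - d\<^sup>2 / (norm x)\<^sup>2"
      using False by (simp add: t_def field_simps power2_eq_square)
    finally have "d\<^sup>2 / (norm x)\<^sup>2 \<le> 0"
      using m_le[of "y + t *\<^sub>R x"] Jy by linarith
    then show ?thesis
      using False by (simp add: divide_le_0_iff d_def)
  qed (simp add: f.zero)
  then show ?thesis
    using that by blast
qed

text \<open>Riesz representation of \<open>inner (A x) y\<close> yields the real part of the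
  identity; the imaginary part is the real part at \<open>\<i> *\<^sub>C x\<close>.\<close>

lemma cadjoint_exists:
  fixes A :: "'a::chilbert_space \<Rightarrow> 'a"
  assumes A: "bounded_clinear A"
  shows "\<exists>B. bounded_clinear B \<and> (\<forall>x y. cinner (A x) y = cinner x (B y))"
proof -
  have "\<exists>z. \<forall>x. inner (A x) y = inner x z" for y
    using riesz_representation[of "\<lambda>x. inner (A x) y"]
      bounded_linear_compose[OF bounded_linear_inner_left bounded_clinear_bounded_linear[OF A]]
    by blast
  then obtain B where B: "\<And>x y. inner (A x) y = inner x (B y)"
    by metis
  have cB: "cinner (A x) y = cinner x (B y)" for x y
  proof (rule complex_eqI)
    show "Re (cinner (A x) y) = Re (cinner x (B y))"
      by (simp add: Re_cinner B)
    have "Re (cinner (A (\<i> *\<^sub>C x)) y) = Re (cinner (\<i> *\<^sub>C x) (B y))"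
      by (simp add: Re_cinner B)
    then show "Im (cinner (A x) y) = Im (cinner x (B y))"
      by (simp add: bounded_clinear_apply[OF A] cinner_simps)
  qed
  have "bounded_clinear B"
  proof (rule bounded_clinearI)
    show "B (x + y) = B x + B y" "B (c *\<^sub>C x) = c *\<^sub>C B x" for x y c
      by (rule cinner_ext; simp add: cinner_simps flip: cB)+
    show "norm (B y) \<le> norm y * onorm A" for y
    proof (cases "B y = 0")
      case False
      have "(norm (B y))\<^sup>2 = Re (cinner (A (B y)) y)"
        by (simp add: cB Re_cinner_self)
      also have "\<dots> \<le> norm (A (B y)) * norm y"
        by (simp add: Re_cinner norm_cauchy_schwarz)
      also have "\<dots> \<le> (onorm A * norm (B y)) * norm y"
        by (intro mult_right_mono bounded_clinear_onorm A) auto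
      finally show ?thesis
        using False by (simp add: power2_eq_square ac_simps)
    qed (use onorm_pos_le[OF bounded_clinear_bounded_linear[OF A]] in simp)
  qed
  then show ?thesis
    using cB by blast
qed

lemma cadjoint_eqI:
  assumes "bounded_clinear B" "\<And>x y. cinner (A x) y = cinner x (B y)"
  shows "cadjoint A = B"
  unfolding cadjoint_def
proof (rule the_equality)
  fix C assume C: "bounded_clinear C \<and> (\<forall>x y. cinner (A x) y = cinner x (C y))"
  show "C = B"
  proof
    show "C y = B y" for y
      by (rule cinner_ext) (use C assms(2) in metis)
  qed
qed (use assms in auto)

lemma
  assumes "bounded_clinear A"
  shows bounded_clinear_cadjoint: "bounded_clinear (cadjoint A)"
    and cinner_cadjoint: "cinner (A x) y = cinner x (cadjoint A y)"
  using cadjoint_exists[OF assms] cadjoint_eqI[of _ A] by metis+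

section \<open>Spectra of self-adjoint operators\<close>

lemma not_in_spectrumI:
  assumes "bounded_clinear B" "\<And>x. A (B x) - z *\<^sub>C B x = x" "\<And>x. B (A x - z *\<^sub>C x) = x"
  shows "z \<notin> spectrum A"
  using assms by (auto simp: spectrum_def mem_bounded_ops fun_eq_iff intro!: bexI[of _ B])

lemma not_in_spectrumE:
  assumes "z \<notin> spectrum A"
  obtains B where "bounded_clinear B" "\<And>x. A (B x) - z *\<^sub>C B x = x" "\<And>x. B (A x - z *\<^sub>C x) = x"
  using assms by (auto simp: spectrum_def mem_bounded_ops fun_eq_iff)

lemma eigenvalue_in_spectrum:
  assumes "A x = z *\<^sub>C x" "x \<noteq> 0"
  shows "z \<in> spectrum A"
proof (rule ccontr)
  assume "z \<notin> spectrum A"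
  then obtain B where "bounded_clinear B" "\<And>x. B (A x - z *\<^sub>C x) = x"
    by (elim not_in_spectrumE) blast
  then show False
    using assms by (metis bounded_clinear_zero diff_self)
qed

text \<open>A Lax-Milgram argument: \<open>L' x = y\<close> is solved as the fixed point of a damped
  iteration, and coercivity bounds the inverse. The factor \<open>\<omega>\<close> rotates the form
  so that its real part becomes coercive.\<close>

lemma not_in_spectrum_if_coercive:
  fixes A :: "'a::chilbert_space \<Rightarrow> 'a"
  assumes A: "bounded_clinear A" and "c > 0"
    and coercive: "\<And>x. c * (norm x)\<^sup>2 \<le> Re (\<omega> * cinner (A x - z *\<^sub>C x) x)"
  shows "z \<notin> spectrum A"
proof -
  define L where "L x = A x - z *\<^sub>C x" for x
  have L: "bounded_clinear L"
    unfolding L_def using A by (intro bounded_clinear_diff bounded_clinear_scaleC_op bounded_clinear_id)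
  define L' where "L' x = \<omega> *\<^sub>C L x" for x
  have L': "bounded_clinear L'"
    unfolding L'_def using L by (rule bounded_clinear_scaleC_op)
  have co: "c * (norm x)\<^sup>2 \<le> inner (L' x) x" for x
    using coercive[of x] by (simp add: L'_def L_def cinner_simps flip: Re_cinner)
  have below: "c * norm x \<le> norm (L' x)" for x
  proof (cases "x = 0")
    case False
    have "c * (norm x)\<^sup>2 \<le> norm (L' x) * norm x"
      using co[of x] norm_cauchy_schwarz[of "L' x" x] by linarith
    then show ?thesis
      using False by (simp add: power2_eq_square)
  qed simp
  \<comment> \<open>Taking \<open>M\<close> at least \<open>c\<close> makes it positive and keeps
    \<open>\<kappa>\<close> at most 1, so that \<open>q\<close> is a genuine square root.\<close>
  define M where "M = max c (onorm L')"
  have M: "norm (L' x) \<le> M * norm x" and "0 < M" for x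
    using bounded_clinear_onorm[OF L', of x] mult_right_mono[of "onorm L'" M "norm x"] \<open>c > 0\<close>
    by (auto simp: M_def)
  have "\<exists>x. L' x = y" for y
  proof -
    \<comment> \<open>The value minimizing
      \<open>1 - 2 * \<rho> * c + \<rho>\<^sup>2 * M\<^sup>2\<close>, the bound for the squared
      contraction factor; the minimum is \<open>1 - \<kappa>\<close>.\<close>
    define \<rho> where "\<rho> = c / M\<^sup>2"
    have "\<rho> > 0"
      using \<open>c > 0\<close> \<open>0 < M\<close> by (simp add: \<rho>_def)
    define \<kappa> where "\<kappa> = c\<^sup>2 / M\<^sup>2"
    have \<rho>c: "\<rho> * (c * t) = \<kappa> * t" and \<rho>M: "\<rho>\<^sup>2 * (M\<^sup>2 * t) = \<kappa> * t" for t
      using \<open>0 < M\<close> by (auto simp: \<rho>_def \<kappa>_def power2_eq_square)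
    define q where "q = sqrt (1 - \<kappa>)"
    have "c\<^sup>2 \<le> M\<^sup>2"
      using \<open>c > 0\<close> by (intro power_mono) (auto simp: M_def)
    then have "0 < \<kappa>" "\<kappa> \<le> 1"
      using \<open>0 < M\<close> \<open>c > 0\<close> by (auto simp: \<kappa>_def)
    then have q2: "q\<^sup>2 = 1 - \<kappa>" and "0 \<le> q" "q < 1"
      by (auto simp: q_def)
    have contr: "norm (x - \<rho> *\<^sub>R L' x) \<le> q * norm x" for x
    proof -
      have "(norm (x - \<rho> *\<^sub>R L' x))\<^sup>2 = (norm x)\<^sup>2 - 2 * \<rho> * inner (L' x) x + \<rho>\<^sup>2 * (norm (L' x))\<^sup>2"
        unfolding power2_norm_eq_inner
        by (simp add: inner_commute algebra_simps power2_eq_square)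
      also have "\<dots> \<le> (norm x)\<^sup>2 - 2 * \<rho> * (c * (norm x)\<^sup>2) + \<rho>\<^sup>2 * (M * norm x)\<^sup>2"
        using \<open>\<rho> > 0\<close> co[of x] M[of x] by (intro add_mono diff_mono mult_left_mono power_mono) auto
      also have "\<dots> = (q * norm x)\<^sup>2"
        by (simp only: power_mult_distrib q2 mult.assoc \<rho>c \<rho>M) (simp add: left_diff_distrib)
      finally show ?thesis
        by (rule power2_le_imp_le) (use \<open>0 \<le> q\<close> in simp)
    qed
    have "\<exists>!x. x - \<rho> *\<^sub>R (L' x - y) = x"
    proof (rule banach_fix_type[OF \<open>0 \<le> q\<close> \<open>q < 1\<close>], intro allI)
      fix x x'
      have "x - \<rho> *\<^sub>R (L' x - y) - (x' - \<rho> *\<^sub>R (L' x' - y)) = (x - x') - \<rho> *\<^sub>R L' (x - x')"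
        by (simp add: bounded_clinear_apply[OF L'] algebra_simps)
      then show "dist (x - \<rho> *\<^sub>R (L' x - y)) (x' - \<rho> *\<^sub>R (L' x' - y)) \<le> q * dist x x'"
        using contr[of "x - x'"] by (simp only: dist_norm)
    qed
    then show ?thesis
      using \<open>\<rho> > 0\<close> by auto
  qed
  moreover have "inj L'"
  proof (rule injI)
    fix x y assume "L' x = L' y"
    then show "x = y"
      using below[of "x - y"] \<open>c > 0\<close> by (simp add: bounded_clinear_apply[OF L'] mult_le_0_iff)
  qed
  ultimately have "bij L'"
    by (metis bijI surjI)
  then have "bounded_clinear (inv L')"
    by (intro bounded_clinear_inv[OF L' _ \<open>c > 0\<close>] below)
  then have I: "bounded_clinear (\<lambda>x. inv L' (\<omega> *\<^sub>C x))"
    by (rule bounded_clinear_compose[OF _ bounded_clinear_scaleC_op[OF bounded_clinear_id]])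
  have "L (inv L' (\<omega> *\<^sub>C x)) = x" for x
  proof (cases "\<omega> = 0")
    \<comment> \<open>For \<open>\<omega> = 0\<close> coercivity leaves only the zero
      vector.\<close>
    case True
    then have "x = 0"
      using below[of x] \<open>c > 0\<close> by (simp add: L'_def mult_le_0_iff)
    then show ?thesis
      using bounded_clinear_zero[OF I] bounded_clinear_zero[OF L] by simp
  next
    case False
    have "L' (inv L' (\<omega> *\<^sub>C x)) = \<omega> *\<^sub>C x"
      using \<open>bij L'\<close> by (simp add: bij_is_surj surj_f_inv_f)
    then show ?thesis
      using False by (simp add: L'_def)
  qed
  moreover have "inv L' (\<omega> *\<^sub>C L x) = x" for x
    using \<open>bij L'\<close> by (simp add: bij_is_inj flip: L'_def)
  ultimately show ?thesis
    using not_in_spectrumI[OF I] by (simp add: L_def)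
qed

definition self_adjoint :: "('a::complex_inner \<Rightarrow> 'a) \<Rightarrow> bool"
  where "self_adjoint A \<longleftrightarrow> bounded_clinear A \<and> (\<forall>x y. cinner (A x) y = cinner x (A y))"

definition positive_op :: "('a::complex_inner \<Rightarrow> 'a) \<Rightarrow> bool"
  where "positive_op A \<longleftrightarrow> self_adjoint A \<and> (\<forall>x. 0 \<le> Re (cinner (A x) x))"

lemma self_adjoint_bounded_clinear: "self_adjoint A \<Longrightarrow> bounded_clinear A"
  and self_adjointD: "self_adjoint A \<Longrightarrow> cinner (A x) y = cinner x (A y)"
  by (auto simp: self_adjoint_def)

lemma self_adjoint_Im: "self_adjoint A \<Longrightarrow> Im (cinner (A x) x) = 0"
  by (metis Reals_cnj_iff cinner_commute complex_is_Real_iff self_adjointD)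

text \<open>Since \<open>cinner (A x) x\<close> is real, multiplication by \<open>\<i>\<close>
  removes it from the real part, and only the contribution of \<open>Im z\<close> remains.\<close>

lemma spectrum_self_adjoint_real:
  fixes A :: "'a::chilbert_space \<Rightarrow> 'a"
  assumes A: "self_adjoint A" and z: "z \<in> spectrum A"
  shows "Im z = 0"
proof (rule ccontr)
  assume nz: "Im z \<noteq> 0"
  have "z \<notin> spectrum A"
  proof (rule not_in_spectrum_if_coercive)
    show "\<bar>Im z\<bar> * (norm x)\<^sup>2 \<le> Re (\<i> * of_real (sgn (Im z)) * cinner (A x - z *\<^sub>C x) x)" for x
      using self_adjoint_Im[OF A, of x] by (simp add: cinner_simps cinner_self abs_sgn algebra_simps)
  qed (use A nz in \<open>auto simp: self_adjoint_def\<close>)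
  then show False
    using z by simp
qed

lemma spectrum_positive_nonneg:
  fixes A :: "'a::chilbert_space \<Rightarrow> 'a"
  assumes A: "positive_op A" and t: "complex_of_real t \<in> spectrum A"
  shows "0 \<le> t"
proof (rule ccontr)
  assume "\<not> 0 \<le> t"
  then have "of_real t \<notin> spectrum A"
    by (intro not_in_spectrum_if_coercive[of _ "- t" 1])
      (use A in \<open>auto simp: cinner_simps cinner_self positive_op_def self_adjoint_def\<close>)
  then show False
    using t by simp
qed

lemma spectrum_le_onorm:
  fixes A :: "'a::chilbert_space \<Rightarrow> 'a"
  assumes A: "bounded_clinear A" and t: "complex_of_real t \<in> spectrum A"
  shows "t \<le> onorm A"
proof (rule ccontr)
  assume t': "\<not> t \<le> onorm A"
  have "of_real t \<notin> spectrum A"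
  proof (rule not_in_spectrum_if_coercive[OF A, of "t - onorm A" "-1"])
    fix x
    have "inner (A x) x \<le> norm (A x) * norm x"
      by (rule norm_cauchy_schwarz)
    also have "\<dots> \<le> onorm A * norm x * norm x"
      by (intro mult_right_mono bounded_clinear_onorm A) auto
    finally show "(t - onorm A) * (norm x)\<^sup>2 \<le> Re (- 1 * cinner (A x - complex_of_real t *\<^sub>C x) x)"
      by (simp add: cinner_simps cinner_self Re_cinner power2_eq_square algebra_simps)
  qed (use t' in auto)
  then show False
    using t by simp
qed

text \<open>If neither \<open>m\<close> nor \<open>- m\<close> were in the spectrum,
  \<open>D\<close>, which factors as \<open>A - m\<close> times \<open>A + m\<close>, would be
  bounded below. Expanding the square of \<open>norm (D x)\<close> then improves the bound
  \<open>m\<close> for \<open>A\<close>, contradicting the choice of \<open>m\<close> as operator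
  norm.\<close>

lemma self_adjoint_onorm_in_spectrum:
  fixes A :: "'a::chilbert_space \<Rightarrow> 'a"
  assumes A: "self_adjoint A" and "onorm A \<noteq> 0"
  obtains t where "\<bar>t\<bar> = onorm A" "complex_of_real t \<in> spectrum A"
proof (rule ccontr)
  assume H: "\<not> thesis"
  define m where "m = onorm A"
  note bA = self_adjoint_bounded_clinear[OF A]
  have "m > 0"
    using assms(2) onorm_pos_le[OF bounded_clinear_bounded_linear[OF bA]] by (simp add: m_def)
  have "complex_of_real m \<notin> spectrum A" "complex_of_real (- m) \<notin> spectrum A"
    using H that[of m] that[of "- m"] \<open>m > 0\<close> by (auto simp: m_def)
  then obtain B C where B: "bounded_clinear B" "\<And>x. B (A x - complex_of_real m *\<^sub>C x) = x"
    and C: "bounded_clinear C" "\<And>x. C (A x - complex_of_real (- m) *\<^sub>C x) = x"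
    by (elim not_in_spectrumE) blast
  define D where "D x = A (A x) - m\<^sup>2 *\<^sub>R x" for x
  have BCD: "C (B (D x)) = x" for x
  proof -
    have "D x = A (A x + m *\<^sub>R x) - m *\<^sub>R (A x + m *\<^sub>R x)"
      by (simp add: D_def bounded_clinear_apply[OF bA] algebra_simps power2_eq_square)
    then have "B (D x) = A x + m *\<^sub>R x"
      using B(2)[of "A x + m *\<^sub>R x"] by (simp add: scaleC_of_real)
    then show ?thesis
      using C(2)[of x] by (simp add: scaleC_of_real del: of_real_minus)
  qed
  have bCB: "bounded_clinear (\<lambda>x. C (B x))"
    using C(1) B(1) by (rule bounded_clinear_compose)
  define k where "k = onorm (\<lambda>x. C (B x)) + 1"
  have "k \<ge> 1"
    using onorm_pos_le[OF bounded_clinear_bounded_linear[OF bCB]] by (simp add: k_def)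
  have kD: "norm x \<le> k * norm (D x)" for x
    using bounded_clinear_onorm[OF bCB, of "D x"]
    by (simp add: BCD k_def algebra_simps add_increasing)
  have D2: "(norm (D x))\<^sup>2 \<le> m\<^sup>2 * (m\<^sup>2 * (norm x)\<^sup>2 - (norm (A x))\<^sup>2)" for x
  proof -
    have "inner (A (A x)) x = (norm (A x))\<^sup>2"
      using self_adjointD[OF A, of "A x" x] by (simp add: power2_norm_eq_inner flip: Re_cinner)
    then have "(norm (D x))\<^sup>2 = (norm (A (A x)))\<^sup>2 - 2 * m\<^sup>2 * (norm (A x))\<^sup>2 + m\<^sup>2 * m\<^sup>2 * (norm x)\<^sup>2"
      by (simp add: D_def power2_norm_eq_inner inner_commute algebra_simps)
    moreover have "(norm (A (A x)))\<^sup>2 \<le> (m * norm (A x))\<^sup>2"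
      using bounded_clinear_onorm[OF bA, of "A x"] by (intro power_mono) (auto simp: m_def)
    ultimately show ?thesis
      by (simp add: power_mult_distrib algebra_simps)
  qed
  \<comment> \<open>Obtained by solving
    \<open>(norm x)\<^sup>2 \<le> k\<^sup>2 * (norm (D x))\<^sup>2\<close> together with
    \<open>D2\<close> for \<open>norm (A x)\<close>.\<close>
  define b where "b = sqrt (m\<^sup>2 - 1 / (k\<^sup>2 * m\<^sup>2))"
  have Ab: "norm (A x) \<le> b * norm x" for x
  proof -
    have "(norm x)\<^sup>2 \<le> (k * norm (D x))\<^sup>2"
      by (intro power_mono kD) auto
    also have "\<dots> \<le> k\<^sup>2 * (m\<^sup>2 * (m\<^sup>2 * (norm x)\<^sup>2 - (norm (A x))\<^sup>2))"
      unfolding power_mult_distrib by (intro mult_left_mono D2) auto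
    finally have "(norm (A x))\<^sup>2 \<le> (m\<^sup>2 - 1 / (k\<^sup>2 * m\<^sup>2)) * (norm x)\<^sup>2"
      using \<open>k \<ge> 1\<close> \<open>m > 0\<close> by (simp add: field_simps)
    then have "sqrt ((norm (A x))\<^sup>2) \<le> sqrt ((m\<^sup>2 - 1 / (k\<^sup>2 * m\<^sup>2)) * (norm x)\<^sup>2)"
      by (rule real_sqrt_le_mono)
    then show ?thesis
      by (simp add: real_sqrt_mult b_def)
  qed
  \<comment> \<open>The function \<open>sqrt\<close> is negative at negative arguments, so the sign
    of \<open>b\<close> is read off from a vector outside the kernel of \<open>A\<close>.\<close>
  obtain x where "A x \<noteq> 0"
    using assms(2) onorm_eq_0[OF bounded_clinear_bounded_linear[OF bA]] by blast
  then have "0 < b * norm x"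
    using Ab[of x] by (meson less_le_trans zero_less_norm_iff)
  then have "0 \<le> b"
    by (simp add: zero_less_mult_iff)
  have "m \<le> b"
    unfolding m_def
    by (rule onorm_bound[OF \<open>0 \<le> b\<close> Ab])
  moreover have "b < sqrt (m\<^sup>2)"
    unfolding b_def using \<open>m > 0\<close> \<open>k \<ge> 1\<close> by (intro real_sqrt_less_mono) auto
  ultimately show False
    using \<open>m > 0\<close> by simp
qed

section \<open>Polynomials of an operator\<close>

text \<open>Complex coefficients let polynomials split into linear factors; \<open>poly_op\<close>
  is the special case of real coefficients.\<close>

definition cpoly_op :: "complex poly \<Rightarrow> ('a::complex_inner \<Rightarrow> 'a) \<Rightarrow> ('a \<Rightarrow> 'a)"
  where "cpoly_op p A = (\<lambda>x. \<Sum>i\<le>degree p. coeff p i *\<^sub>C (A ^^ i) x)"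

lemma cpoly_op_altdef:
  assumes "degree p \<le> n"
  shows "cpoly_op p A x = (\<Sum>i\<le>n. coeff p i *\<^sub>C (A ^^ i) x)"
  unfolding cpoly_op_def by (rule sum.mono_neutral_left) (use assms in \<open>auto simp: coeff_eq_0\<close>)

lemma cpoly_op_add: "cpoly_op (p + q) A x = cpoly_op p A x + cpoly_op q A x"
  using degree_add_le_max[of p q]
  by (simp add: cpoly_op_altdef[of _ "max (degree p) (degree q)"] scaleC_add_left sum.distrib)

lemma cpoly_op_smult: "cpoly_op (smult c p) A x = c *\<^sub>C cpoly_op p A x"
  by (simp add: cpoly_op_altdef[of _ "degree p"] degree_smult_le complex_vector.scale_sum_right)

lemma cpoly_op_pCons:
  assumes A: "bounded_clinear A"
  shows "cpoly_op (pCons a p) A x = a *\<^sub>C x + A (cpoly_op p A x)"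
proof -
  have "cpoly_op (pCons a p) A x
      = (\<Sum>i\<le>Suc (degree p). coeff (pCons a p) i *\<^sub>C (A ^^ i) x)"
    by (rule cpoly_op_altdef) (simp add: degree_pCons_le)
  also have "\<dots> = a *\<^sub>C x + (\<Sum>i\<le>degree p. A (coeff p i *\<^sub>C (A ^^ i) x))"
    by (subst sum.atMost_Suc_shift) (simp add: bounded_clinear_scaleC[OF A])
  also have "\<dots> = a *\<^sub>C x + A (cpoly_op p A x)"
    using bounded_clinear_bounded_linear[OF A]
    by (simp add: cpoly_op_def linear_sum bounded_linear.linear)
  finally show ?thesis .
qed

lemma cpoly_op_0 [simp]: "cpoly_op 0 A x = 0"
  by (simp add: cpoly_op_def)

lemma cpoly_op_mult:
  assumes A: "bounded_clinear A"
  shows "cpoly_op (p * q) A x = cpoly_op p A (cpoly_op q A x)"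
  by (induction p)
     (simp_all add: cpoly_op_pCons[OF A] cpoly_op_add cpoly_op_smult)

lemma bounded_clinear_cpoly_op:
  assumes A: "bounded_clinear A"
  shows "bounded_clinear (cpoly_op p A)"
proof (induction p)
  case 0
  then show ?case
    using bounded_clinear_zero_op by (simp add: cpoly_op_def)
next
  case (pCons a p)
  have "cpoly_op (pCons a p) A = (\<lambda>x. a *\<^sub>C x + A (cpoly_op p A x))"
    by (simp add: fun_eq_iff cpoly_op_pCons[OF A])
  then show ?case
    by (simp only:) (intro bounded_clinear_add bounded_clinear_scaleC_op bounded_clinear_id
        bounded_clinear_compose[OF A pCons(2)])
qed

text \<open>One inclusion of the spectral mapping theorem, by induction on the degree: splitting off
  a root \<open>z\<close> exhibits \<open>q(A)\<close> as the product of the invertible operators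
  \<open>A - z\<close> and \<open>q'(A)\<close>.\<close>

lemma cpoly_op_invertible:
  assumes A: "bounded_clinear A" and "q \<noteq> 0" and "\<And>z. poly q z = 0 \<Longrightarrow> z \<notin> spectrum A"
  shows "\<exists>B. bounded_clinear B \<and> (\<forall>x. cpoly_op q A (B x) = x \<and> B (cpoly_op q A x) = x)"
  using assms(2,3)
proof (induction "degree q" arbitrary: q rule: less_induct)
  case less
  show ?case
  proof (cases "degree q = 0")
    case True
    then obtain c where "q = [:c:]"
      by (rule degree_eq_zeroE)
    then have "c \<noteq> 0" and "cpoly_op q A x = c *\<^sub>C x" for x
      using less.prems(1) bounded_clinear_zero[OF A] by (auto simp: cpoly_op_pCons[OF A])
    then show ?thesis
      using bounded_clinear_scaleC_op[OF bounded_clinear_id, of "1 / c"]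
      by (intro exI[of _ "\<lambda>x. (1 / c) *\<^sub>C x"]) simp
  next
    case False
    then obtain z where z: "poly q z = 0"
      using alg_closed_imp_poly_has_root[of q] by auto
    then obtain q' where q': "q = [:- z, 1:] * q'"
      by (auto simp: poly_eq_0_iff_dvd)
    then have "q' \<noteq> 0"
      using less.prems(1) by auto
    then have "degree q' < degree q"
      unfolding q' by (subst degree_mult_eq) auto
    then obtain C where C: "bounded_clinear C" "\<And>x. cpoly_op q' A (C x) = x" "\<And>x. C (cpoly_op q' A x) = x"
      using less.hyps[of q'] \<open>q' \<noteq> 0\<close> less.prems(2) q' by auto
    obtain B where B: "bounded_clinear B" "\<And>x. A (B x) - z *\<^sub>C B x = x" "\<And>x. B (A x - z *\<^sub>C x) = x"
      using less.prems(2)[OF z] by (rule not_in_spectrumE) blast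
    have "cpoly_op q A x = A (cpoly_op q' A x) - z *\<^sub>C cpoly_op q' A x" for x
      unfolding q' cpoly_op_mult[OF A]
      by (simp add: cpoly_op_pCons[OF A] bounded_clinear_apply[OF A] del: mult_pCons_left)
    then show ?thesis
      using B C by (intro exI[of _ "\<lambda>x. C (B x)"] conjI bounded_clinear_compose[OF C(1) B(1)]) auto
  qed
qed

abbreviation of_real_poly :: "real poly \<Rightarrow> complex poly"
  where "of_real_poly \<equiv> map_poly complex_of_real"

lemma of_real_poly_diff: "of_real_poly (p - q) = of_real_poly p - of_real_poly q"
  and of_real_poly_mult: "of_real_poly (p * q) = of_real_poly p * of_real_poly q"
  by (rule poly_eqI; simp add: coeff_map_poly coeff_mult)+

lemma poly_of_real_poly: "poly (of_real_poly p) (complex_of_real t) = complex_of_real (poly p t)"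
  by (induction p) (simp_all add: map_poly_pCons)

lemma poly_op_eq_cpoly_op:
  fixes A :: "'a::complex_inner \<Rightarrow> 'a"
  shows "poly_op p A = cpoly_op (of_real_poly p) A"
  by (simp add: poly_op_def cpoly_op_def coeff_map_poly degree_map_poly scaleC_of_real)

lemma poly_op_0 [simp]: "poly_op 0 A x = 0"
  by (simp add: poly_op_def)

lemma poly_op_pCons: "bounded_clinear A \<Longrightarrow> poly_op (pCons a p) A x = a *\<^sub>R x + A (poly_op p A x)"
  by (simp add: poly_op_eq_cpoly_op map_poly_pCons cpoly_op_pCons scaleC_of_real)

lemma poly_op_diff:
  fixes A :: "'a::complex_inner \<Rightarrow> 'a"
  shows "poly_op (p - q) A x = poly_op p A x - poly_op q A x"
  using cpoly_op_add[of "of_real_poly (p - q)" "of_real_poly q" A x]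
  by (simp add: poly_op_eq_cpoly_op of_real_poly_diff)

lemma poly_op_mult: "bounded_clinear A \<Longrightarrow> poly_op (p * q) A x = poly_op p A (poly_op q A x)"
  by (simp add: poly_op_eq_cpoly_op of_real_poly_mult cpoly_op_mult)

lemma bounded_clinear_poly_op: "bounded_clinear A \<Longrightarrow> bounded_clinear (poly_op p A)"
  by (simp add: poly_op_eq_cpoly_op bounded_clinear_cpoly_op)

lemma self_adjoint_poly_op:
  assumes A: "self_adjoint A"
  shows "self_adjoint (poly_op p A)"
proof -
  note bA = self_adjoint_bounded_clinear[OF A]
  have comm: "poly_op p A (A x) = A (poly_op p A x)" for p x
    by (induction p) (simp_all add: poly_op_pCons[OF bA] bounded_clinear_apply[OF bA])
  have "cinner (poly_op p A x) y = cinner x (poly_op p A y)" for x y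
    by (induction p arbitrary: y)
      (simp_all add: poly_op_pCons[OF bA] cinner_simps self_adjointD[OF A] comm)
  then show ?thesis
    using bounded_clinear_poly_op[OF bA] by (simp add: self_adjoint_def)
qed

lemma spectrum_self_adjoint_nonempty:
  fixes A :: "'a::chilbert_space \<Rightarrow> 'a"
  assumes A: "self_adjoint A" and "x \<noteq> (0::'a)"
  obtains t where "complex_of_real t \<in> spectrum A"
proof (cases "onorm A = 0")
  case True
  then have "A x = complex_of_real 0 *\<^sub>C x"
    using A by (simp add: self_adjoint_def bounded_clinear_bounded_linear onorm_eq_0)
  then show ?thesis
    using that assms(2) by (blast intro: eigenvalue_in_spectrum)
next
  case False
  then show ?thesis
    using self_adjoint_onorm_in_spectrum[OF A] that by blast
qed

text \<open>The norm of the self-adjoint operator \<open>p(A)\<close> is attained as the modulus of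
  some \<open>t\<close> in its spectrum, and spectral mapping writes \<open>t\<close> as
  \<open>poly p s\<close> with \<open>s\<close> in the spectrum of \<open>A\<close>. This bound
  drives the whole functional calculus.\<close>

lemma norm_poly_op_le:
  fixes A :: "'a::chilbert_space \<Rightarrow> 'a"
  assumes A: "self_adjoint A" and "0 \<le> \<epsilon>"
    and le: "\<And>t. complex_of_real t \<in> spectrum A \<Longrightarrow> \<bar>poly p t\<bar> \<le> \<epsilon>"
  shows "norm (poly_op p A x) \<le> \<epsilon> * norm x"
proof -
  note bA = self_adjoint_bounded_clinear[OF A]
  have "onorm (poly_op p A) \<le> \<epsilon>"
  proof (cases "onorm (poly_op p A) = 0")
    case False
    then obtain t where t: "\<bar>t\<bar> = onorm (poly_op p A)" "complex_of_real t \<in> spectrum (poly_op p A)"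
      using self_adjoint_onorm_in_spectrum[OF self_adjoint_poly_op[OF A]] by blast
    have "\<exists>s. complex_of_real s \<in> spectrum A \<and> poly p s = t"
    proof (cases "p = [:t:]")
      \<comment> \<open>Here \<open>p - [:t:]\<close> is zero and has no informative roots; any
        point of the nonempty spectrum serves.\<close>
      case True
      obtain y where "poly_op p A y \<noteq> 0"
        using False onorm_eq_0[OF bounded_clinear_bounded_linear[OF bounded_clinear_poly_op[OF bA]]]
        by blast
      then have "y \<noteq> 0"
        using bounded_clinear_zero[OF bounded_clinear_poly_op[OF bA]] by metis
      then show ?thesis
        using True by (auto elim: spectrum_self_adjoint_nonempty[OF A])
    next
      case False
      define q where "q = of_real_poly (p - [:t:])"
      have q: "cpoly_op q A x = poly_op p A x - complex_of_real t *\<^sub>C x" for x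
        using poly_op_diff[of p "[:t:]" A x] bounded_clinear_zero[OF bA]
        by (simp add: q_def poly_op_pCons[OF bA] scaleC_of_real flip: poly_op_eq_cpoly_op)
      have "q \<noteq> 0"
        using False by (simp add: q_def map_poly_eq_0_iff)
      moreover have "\<nexists>B. bounded_clinear B \<and> (\<forall>x. cpoly_op q A (B x) = x \<and> B (cpoly_op q A x) = x)"
        using t(2) not_in_spectrumI[of _ "poly_op p A" "complex_of_real t"] unfolding q by blast
      ultimately obtain z where z: "poly q z = 0" "z \<in> spectrum A"
        using cpoly_op_invertible[OF bA] by blast
      have "z = complex_of_real (Re z)"
        using spectrum_self_adjoint_real[OF A z(2)] by (simp add: complex_eq_iff)
      moreover from this have "poly p (Re z) = t"
        using z(1) poly_of_real_poly[of "p - [:t:]" "Re z"] by (simp add: q_def)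
      ultimately show ?thesis
        using z(2) by metis
    qed
    then show ?thesis
      using le t(1) by fastforce
  qed (use \<open>0 \<le> \<epsilon>\<close> in simp)
  then show ?thesis
    by (meson bounded_clinear_onorm[OF bounded_clinear_poly_op[OF bA]] mult_right_mono norm_ge_zero order_trans)
qed

section \<open>Continuous functional calculus\<close>

lemma bounded_linear_cinner_left: "bounded_linear (\<lambda>x. cinner x y)"
  by (rule bounded_linear_intro[of _ "norm y"])
    (auto simp: cinner_simps scaleR_conv_of_real cinner_Cauchy_Schwarz)

lemma bounded_linear_cinner_right: "bounded_linear (\<lambda>y. cinner x y)"
  by (rule bounded_linear_intro[of _ "norm x"])
    (use cinner_Cauchy_Schwarz[of x] in \<open>auto simp: cinner_simps scaleR_conv_of_real mult.commute\<close>)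

lemmas tendsto_cinner_left = bounded_linear.tendsto[OF bounded_linear_cinner_left]
lemmas tendsto_cinner_right = bounded_linear.tendsto[OF bounded_linear_cinner_right]

abbreviation real_spectrum :: "('a::complex_inner \<Rightarrow> 'a) \<Rightarrow> real set"
  where "real_spectrum A \<equiv> {t. complex_of_real t \<in> spectrum A}"

text \<open>The condition under the definite description in \<open>cfc\<close>, isolated so that
  existence and uniqueness can be proved about it.\<close>

definition cfc_lim :: "(real \<Rightarrow> real) \<Rightarrow> ('a::complex_inner \<Rightarrow> 'a) \<Rightarrow> ('a \<Rightarrow> 'a) \<Rightarrow> bool"
  where "cfc_lim f A X \<longleftrightarrow> X \<in> bounded_ops \<and>
    (\<exists>p. uniform_limit (real_spectrum A) (\<lambda>n. poly (p n)) f sequentially \<and>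
         (\<lambda>n. onorm (\<lambda>x. poly_op (p n) A x - X x)) \<longlonglongrightarrow> 0)"

lemma tendsto_if_onorm_tendsto:
  assumes "\<And>n. bounded_clinear (P n)" "bounded_clinear X"
    and lim: "(\<lambda>n. onorm (\<lambda>x. P n x - X x)) \<longlonglongrightarrow> 0"
  shows "(\<lambda>n. P n x) \<longlonglongrightarrow> X x"
proof (rule LIM_zero_cancel, rule Lim_null_comparison)
  show "\<forall>\<^sub>F n in sequentially. norm (P n x - X x) \<le> onorm (\<lambda>x. P n x - X x) * norm x"
    using bounded_clinear_onorm[OF bounded_clinear_diff[OF assms(1,2)]] by auto
  show "(\<lambda>n. onorm (\<lambda>x. P n x - X x) * norm x) \<longlonglongrightarrow> 0"
    using tendsto_mult_left_zero[OF lim] .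
qed

text \<open>Two approximating sequences differ by polynomials tending to 0 uniformly on the
  spectrum, so by \<open>norm_poly_op_le\<close> the operators have the same limit. This yields
  uniqueness and frees later proofs to choose the sequence.\<close>

lemma cfc_lim_tendsto:
  fixes A :: "'a::chilbert_space \<Rightarrow> 'a"
  assumes A: "self_adjoint A" and X: "cfc_lim f A X"
    and q: "uniform_limit (real_spectrum A) (\<lambda>n. poly (q n)) f sequentially"
  shows "(\<lambda>n. poly_op (q n) A x) \<longlonglongrightarrow> X x"
proof -
  note bA = self_adjoint_bounded_clinear[OF A]
  obtain p where p: "uniform_limit (real_spectrum A) (\<lambda>n. poly (p n)) f sequentially"
    and lim: "(\<lambda>n. onorm (\<lambda>x. poly_op (p n) A x - X x)) \<longlonglongrightarrow> 0"
    using X by (auto simp: cfc_lim_def)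
  have px: "(\<lambda>n. poly_op (p n) A x) \<longlonglongrightarrow> X x"
    using X by (intro tendsto_if_onorm_tendsto bounded_clinear_poly_op[OF bA] lim)
      (auto simp: cfc_lim_def mem_bounded_ops)
  have "(\<lambda>n. poly_op (q n - p n) A x) \<longlonglongrightarrow> 0"
  proof (rule LIMSEQ_I)
    fix e :: real assume "e > 0"
    \<comment> \<open>The summand 1 covers \<open>x = 0\<close> and makes the final estimate
      strict.\<close>
    define \<delta> where "\<delta> = e / (norm x + 1)"
    have "\<delta> > 0"
      using \<open>e > 0\<close> by (simp add: \<delta>_def add_nonneg_pos)
    have "\<forall>\<^sub>F n in sequentially. \<forall>t\<in>real_spectrum A. dist (poly (q n) t - poly (p n) t) (f t - f t) < \<delta>"
      using uniform_limitD[OF uniform_limit_minus[OF q p] \<open>\<delta> > 0\<close>] .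
    then have "\<forall>\<^sub>F n in sequentially. norm (poly_op (q n - p n) A x - 0) < e"
    proof eventually_elim
      case (elim n)
      have "norm (poly_op (q n - p n) A x) \<le> \<delta> * norm x"
        by (rule norm_poly_op_le[OF A]) (use elim \<open>\<delta> > 0\<close> in \<open>auto simp: dist_norm less_imp_le\<close>)
      also have "\<dots> < \<delta> * (norm x + 1)"
        using \<open>\<delta> > 0\<close> by simp
      also have "\<dots> = e"
        using norm_ge_zero[of x] unfolding \<delta>_def by (simp add: add_nonneg_eq_0_iff)
      finally show ?case
        by simp
    qed
    then show "\<exists>N. \<forall>n\<ge>N. norm (poly_op (q n - p n) A x - 0) < e"
      by (simp add: eventually_sequentially)
  qed
  then have "(\<lambda>n. poly_op (q n - p n) A x + poly_op (p n) A x) \<longlonglongrightarrow> 0 + X x"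
    by (intro tendsto_add px)
  then show ?thesis
    by (simp add: poly_op_diff)
qed

lemma cfc_eqI:
  fixes A :: "'a::chilbert_space \<Rightarrow> 'a"
  assumes A: "self_adjoint A" and X: "cfc_lim f A X"
  shows "cfc f A = X"
proof -
  have "Y = X" if Y: "cfc_lim f A Y" for Y
  proof
    fix x
    obtain p where "uniform_limit (real_spectrum A) (\<lambda>n. poly (p n)) f sequentially"
      using X by (auto simp: cfc_lim_def)
    then show "Y x = X x"
      using cfc_lim_tendsto[OF A X] cfc_lim_tendsto[OF A Y] LIMSEQ_unique by blast
  qed
  then show ?thesis
    using X unfolding cfc_def cfc_lim_def[symmetric] by (intro the_equality)
qed

lemma real_poly_approx:
  fixes f :: "real \<Rightarrow> real"
  assumes "continuous_on {a..b} f" "0 < e"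
  obtains p where "\<And>t. t \<in> {a..b} \<Longrightarrow> \<bar>poly p t - f t\<bar> < e"
proof -
  obtain g where g: "real_polynomial_function g" "\<And>t. t \<in> {a..b} \<Longrightarrow> \<bar>f t - g t\<bar> < e"
    using Stone_Weierstrass_real_polynomial_function[OF compact_Icc assms] by blast
  obtain c n where "g = (\<lambda>x. \<Sum>i\<le>n. c i * x ^ i)"
    using g(1) by (auto simp: real_polynomial_function_iff_sum)
  then have "poly (\<Sum>i\<le>n. monom (c i) i) t = g t" for t
    by (simp add: poly_sum poly_monom)
  then show ?thesis
    using g(2) by (intro that[of "\<Sum>i\<le>n. monom (c i) i"]) (simp add: abs_minus_commute)
qed

text \<open>Weierstrass polynomials on an interval containing the spectrum give operators that are
  Cauchy at a rate proportional to \<open>norm x\<close>. Their pointwise limit is therefore also a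
  limit in operator norm.\<close>

lemma cfc_lim_exists:
  fixes A :: "'a::chilbert_space \<Rightarrow> 'a"
  assumes A: "self_adjoint A" and S: "real_spectrum A \<subseteq> {a..b}" and f: "continuous_on {a..b} f"
  shows "\<exists>X. cfc_lim f A X"
proof -
  note bA = self_adjoint_bounded_clinear[OF A]
  note bp = bounded_clinear_poly_op[OF bA]
  have "\<exists>p. \<forall>t\<in>{a..b}. \<bar>poly p t - f t\<bar> < 1 / Suc n" for n
    using real_poly_approx[OF f, of "1 / Suc n"] by (metis of_nat_0_less_iff zero_less_Suc zero_less_divide_1_iff)
  then obtain p where p: "\<And>n t. t \<in> {a..b} \<Longrightarrow> \<bar>poly (p n) t - f t\<bar> < 1 / Suc n"
    by metis
  have lim0: "(\<lambda>n. 1 / real (Suc n)) \<longlonglongrightarrow> 0"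
    using LIMSEQ_inverse_real_of_nat by (simp add: inverse_eq_divide)
  have diff: "norm (poly_op (p n) A x - poly_op (p m) A x) \<le> (1 / Suc n + 1 / Suc m) * norm x" for n m x
    unfolding poly_op_diff[symmetric]
  proof (rule norm_poly_op_le[OF A])
    fix t assume "complex_of_real t \<in> spectrum A"
    then have "t \<in> {a..b}"
      using S by auto
    from p[OF this, of n] p[OF this, of m]
    show "\<bar>poly (p n - p m) t\<bar> \<le> 1 / Suc n + 1 / Suc m"
      by simp
  qed simp
  have "Cauchy (\<lambda>n. poly_op (p n) A x)" for x
  proof (rule metric_CauchyI)
    fix e :: real assume "e > 0"
    have "(\<lambda>n. 1 / real (Suc n) * (2 * norm x)) \<longlonglongrightarrow> 0"
      by (rule tendsto_mult_left_zero[OF lim0])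
    then have "\<forall>\<^sub>F n in sequentially. 1 / real (Suc n) * (2 * norm x) < e"
      using \<open>e > 0\<close> by (rule order_tendstoD)
    then obtain N where N: "1 / real (Suc N) * (2 * norm x) < e"
      by (auto simp: eventually_sequentially)
    have "dist (poly_op (p n) A x) (poly_op (p m) A x) < e" if "n \<ge> N" "m \<ge> N" for n m
    proof -
      have "1 / real (Suc n) + 1 / real (Suc m) \<le> 1 / real (Suc N) + 1 / real (Suc N)"
        using that by (intro add_mono divide_left_mono) auto
      then have "(1 / real (Suc n) + 1 / real (Suc m)) * norm x \<le> (1 / real (Suc N) + 1 / real (Suc N)) * norm x"
        by (rule mult_right_mono) auto
      then show ?thesis
        using diff[of n x m] N by (simp add: dist_norm)
    qed
    then show "\<exists>M. \<forall>n\<ge>M. \<forall>m\<ge>M. dist (poly_op (p n) A x) (poly_op (p m) A x) < e"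
      by blast
  qed
  then have "\<exists>y. (\<lambda>n. poly_op (p n) A x) \<longlonglongrightarrow> y" for x
    using Cauchy_convergent convergent_def by blast
  then obtain X where X: "\<And>x. (\<lambda>n. poly_op (p n) A x) \<longlonglongrightarrow> X x"
    by metis
  \<comment> \<open>Let \<open>m\<close> tend to infinity in \<open>diff\<close>; the resulting
    constant does not depend on \<open>x\<close>.\<close>
  have pX: "norm (poly_op (p n) A x - X x) \<le> 1 / Suc n * norm x" for n x
  proof (rule tendsto_le)
    show "(\<lambda>m. (1 / Suc n + 1 / Suc m) * norm x) \<longlonglongrightarrow> 1 / Suc n * norm x"
      using tendsto_mult_right[OF tendsto_add[OF tendsto_const lim0], of "1 / Suc n" "norm x"] by simp
    show "(\<lambda>m. norm (poly_op (p n) A x - poly_op (p m) A x)) \<longlonglongrightarrow> norm (poly_op (p n) A x - X x)"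
      by (intro tendsto_intros X)
  qed (use diff in auto)
  have bX: "bounded_clinear X"
  proof (rule bounded_clinearI)
    fix x y c
    have "(\<lambda>n. poly_op (p n) A x + poly_op (p n) A y) \<longlonglongrightarrow> X (x + y)"
      using X[of "x + y"] by (simp add: bounded_clinear_apply[OF bp])
    then show "X (x + y) = X x + X y"
      using tendsto_add[OF X[of x] X[of y]] by (rule LIMSEQ_unique)
    have "(\<lambda>n. c *\<^sub>C poly_op (p n) A x) \<longlonglongrightarrow> X (c *\<^sub>C x)"
      using X[of "c *\<^sub>C x"] by (simp add: bounded_clinear_apply[OF bp])
    moreover have "(\<lambda>n. c *\<^sub>C poly_op (p n) A x) \<longlonglongrightarrow> c *\<^sub>C X x"
      using bounded_linear.tendsto[OF bounded_clinear_bounded_linear[OF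
            bounded_clinear_scaleC_op[OF bounded_clinear_id]] X] .
    ultimately show "X (c *\<^sub>C x) = c *\<^sub>C X x"
      by (rule LIMSEQ_unique)
    show "norm (X x) \<le> norm x * (onorm (poly_op (p 0) A) + 1)"
      using pX[of 0 x] bounded_clinear_onorm[OF bp, of "p 0" x] norm_triangle_ineq4[of "poly_op (p 0) A x" "poly_op (p 0) A x - X x"]
      by (simp add: algebra_simps)
  qed
  have "(\<lambda>n. onorm (\<lambda>x. poly_op (p n) A x - X x)) \<longlonglongrightarrow> 0"
  proof (rule tendsto_sandwich[OF _ _ tendsto_const lim0])
    show "\<forall>\<^sub>F n in sequentially. onorm (\<lambda>x. poly_op (p n) A x - X x) \<le> 1 / real (Suc n)"
      using onorm_bound[OF _ pX] by auto
  qed (intro always_eventually allI onorm_pos_le bounded_clinear_bounded_linear bounded_clinear_diff bp bX)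
  moreover have "uniform_limit (real_spectrum A) (\<lambda>n. poly (p n)) f sequentially"
  proof (rule uniform_limitI)
    fix e :: real assume "e > 0"
    with lim0 have "\<forall>\<^sub>F n in sequentially. 1 / real (Suc n) < e"
      by (rule order_tendstoD)
    then show "\<forall>\<^sub>F n in sequentially. \<forall>t\<in>real_spectrum A. dist (poly (p n) t) (f t) < e"
    proof eventually_elim
      case (elim n)
      show ?case
        using p[of _ n] elim S by (force simp: dist_real_def)
    qed
  qed
  ultimately show ?thesis
    using bX by (auto simp: cfc_lim_def mem_bounded_ops)
qed

section \<open>Functional calculus of a positive operator\<close>

context
  fixes A :: "'a::chilbert_space \<Rightarrow> 'a"
  assumes A: "positive_op A"
begin

lemma positive_op_self_adjoint: "self_adjoint A"
  using A by (simp add: positive_op_def)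

lemma real_spectrum_positive_op: "real_spectrum A \<subseteq> {0..onorm A}"
  using spectrum_positive_nonneg[OF A] positive_op_self_adjoint
    spectrum_le_onorm[OF self_adjoint_bounded_clinear] by auto

lemma cfc_lim_cfc:
  assumes f: "continuous_on {0..} f"
  shows "cfc_lim f A (cfc f A)"
proof -
  have "continuous_on {0..onorm A} f"
    using f by (rule continuous_on_subset) auto
  then obtain X where "cfc_lim f A X"
    using cfc_lim_exists[OF positive_op_self_adjoint real_spectrum_positive_op] by blast
  then show ?thesis
    using cfc_eqI[OF positive_op_self_adjoint] by blast
qed

lemma bounded_clinear_cfc: "continuous_on {0..} f \<Longrightarrow> bounded_clinear (cfc f A)"
  using cfc_lim_cfc by (auto simp: cfc_lim_def mem_bounded_ops)

text \<open>The calculus sees \<open>f\<close> only through uniform limits on the spectrum, which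
  lies in the nonnegative reals.\<close>

lemma cfc_cong:
  assumes "\<And>t. 0 \<le> t \<Longrightarrow> f t = g t"
  shows "cfc f A = cfc g A"
proof -
  have "uniform_limit (real_spectrum A) P f sequentially
      \<longleftrightarrow> uniform_limit (real_spectrum A) P g sequentially" for P :: "nat \<Rightarrow> real \<Rightarrow> real"
    using real_spectrum_positive_op assms by (intro uniform_limit_cong') auto
  then show ?thesis
    by (simp add: cfc_def)
qed

lemma cfc_id: "cfc (\<lambda>t. t) A = A"
proof (rule cfc_eqI[OF positive_op_self_adjoint])
  note bA = self_adjoint_bounded_clinear[OF positive_op_self_adjoint]
  have "poly_op [:0, 1:] A = A"
    by (simp add: fun_eq_iff poly_op_pCons[OF bA] bounded_clinear_zero[OF bA])
  moreover have "uniform_limit (real_spectrum A) (\<lambda>n. poly [:0, 1:]) (\<lambda>t. t) sequentially"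
    by (rule uniform_limitI) simp
  ultimately show "cfc_lim (\<lambda>t. t) A A"
    using bA unfolding cfc_lim_def mem_bounded_ops
    by (intro conjI exI[of _ "\<lambda>_. [:0, 1:]"]) (auto simp: onorm_zero)
qed

lemma self_adjoint_cfc:
  assumes f: "continuous_on {0..} f"
  shows "self_adjoint (cfc f A)"
proof -
  obtain p where p: "uniform_limit (real_spectrum A) (\<lambda>n. poly (p n)) f sequentially"
    using cfc_lim_cfc[OF f] by (auto simp: cfc_lim_def)
  note lim = cfc_lim_tendsto[OF positive_op_self_adjoint cfc_lim_cfc[OF f] p]
  have "cinner (cfc f A x) y = cinner x (cfc f A y)" for x y
  proof (rule LIMSEQ_unique)
    show "(\<lambda>n. cinner (poly_op (p n) A x) y) \<longlonglongrightarrow> cinner (cfc f A x) y"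
      by (rule tendsto_cinner_left[OF lim])
    show "(\<lambda>n. cinner (poly_op (p n) A x) y) \<longlonglongrightarrow> cinner x (cfc f A y)"
      unfolding self_adjointD[OF self_adjoint_poly_op[OF positive_op_self_adjoint]]
      by (rule tendsto_cinner_right[OF lim])
  qed
  then show ?thesis
    using bounded_clinear_cfc[OF f] by (simp add: self_adjoint_def)
qed

text \<open>Products of approximating polynomials approximate the product uniformly, because
  \<open>f\<close> and \<open>g\<close> are bounded on the spectrum. On the operator side, norm
  convergence of \<open>p n\<close> at \<open>A\<close> is applied to a convergent sequence of
  vectors.\<close>

lemma cfc_mult:
  assumes f: "continuous_on {0..} f" and g: "continuous_on {0..} g"
  shows "cfc (\<lambda>t. f t * g t) A x = cfc f A (cfc g A x)"
proof -
  note sA = positive_op_self_adjoint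
  note bA = self_adjoint_bounded_clinear[OF sA]
  obtain p where p: "uniform_limit (real_spectrum A) (\<lambda>n. poly (p n)) f sequentially"
    and plim: "(\<lambda>n. onorm (\<lambda>x. poly_op (p n) A x - cfc f A x)) \<longlonglongrightarrow> 0"
    using cfc_lim_cfc[OF f] by (auto simp: cfc_lim_def)
  obtain q where q: "uniform_limit (real_spectrum A) (\<lambda>n. poly (q n)) g sequentially"
    using cfc_lim_cfc[OF g] by (auto simp: cfc_lim_def)
  have bounded: "bounded (h ` real_spectrum A)" if "continuous_on {0..} h" for h :: "real \<Rightarrow> real"
  proof (rule bounded_subset)
    show "bounded (h ` {0..onorm A})"
      by (intro compact_imp_bounded compact_continuous_image continuous_on_subset[OF that]) auto
  qed (use real_spectrum_positive_op in blast)
  have "uniform_limit (real_spectrum A) (\<lambda>n. poly (p n * q n)) (\<lambda>t. f t * g t) sequentially"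
    using uniform_lim_mult[OF p q bounded[OF f] bounded[OF g]] by (simp add: uniform_limit_iff)
  then have pq: "(\<lambda>n. poly_op (p n) A (poly_op (q n) A x)) \<longlonglongrightarrow> cfc (\<lambda>t. f t * g t) A x"
    using cfc_lim_tendsto[OF sA cfc_lim_cfc[OF continuous_on_mult[OF f g]], of "\<lambda>n. p n * q n" x]
    by (simp only: poly_op_mult[OF bA])
  define Y where "Y = cfc g A x"
  have qY: "(\<lambda>n. poly_op (q n) A x) \<longlonglongrightarrow> Y"
    unfolding Y_def by (rule cfc_lim_tendsto[OF sA cfc_lim_cfc[OF g] q])
  have "(\<lambda>n. poly_op (p n) A (poly_op (q n) A x) - cfc f A (poly_op (q n) A x)) \<longlonglongrightarrow> 0"
  proof (rule Lim_null_comparison)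
    show "\<forall>\<^sub>F n in sequentially. norm (poly_op (p n) A (poly_op (q n) A x) - cfc f A (poly_op (q n) A x))
        \<le> onorm (\<lambda>x. poly_op (p n) A x - cfc f A x) * norm (poly_op (q n) A x)"
      using bounded_clinear_onorm[OF bounded_clinear_diff[OF bounded_clinear_poly_op[OF bA] bounded_clinear_cfc[OF f]]]
      by auto
    show "(\<lambda>n. onorm (\<lambda>x. poly_op (p n) A x - cfc f A x) * norm (poly_op (q n) A x)) \<longlonglongrightarrow> 0"
      using tendsto_mult[OF plim tendsto_norm[OF qY]] by simp
  qed
  moreover have "(\<lambda>n. cfc f A (poly_op (q n) A x)) \<longlonglongrightarrow> cfc f A Y"
    by (rule bounded_linear.tendsto[OF bounded_clinear_bounded_linear[OF bounded_clinear_cfc[OF f]] qY])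
  ultimately have "(\<lambda>n. poly_op (p n) A (poly_op (q n) A x) - cfc f A (poly_op (q n) A x)
      + cfc f A (poly_op (q n) A x)) \<longlonglongrightarrow> 0 + cfc f A Y"
    by (rule tendsto_add)
  then show ?thesis
    using LIMSEQ_unique[OF pq] by (simp add: Y_def)
qed

text \<open>The square root of \<open>f\<close> gives a self-adjoint \<open>X\<close> with
  \<open>X (X x) = cfc f A x\<close>, so the form at \<open>x\<close> is the squared norm of
  \<open>X x\<close>.\<close>

lemma positive_op_cfc:
  assumes f: "continuous_on {0..} f" and pos: "\<And>t. 0 \<le> t \<Longrightarrow> 0 \<le> f t"
  shows "positive_op (cfc f A)"
proof -
  define X where "X = cfc (\<lambda>t. sqrt (f t)) A"
  have s: "continuous_on {0..} (\<lambda>t. sqrt (f t))"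
    using f by (rule continuous_on_real_sqrt)
  have "cfc f A = cfc (\<lambda>t. sqrt (f t) * sqrt (f t)) A"
    by (rule cfc_cong) (use pos in simp)
  then have "cfc f A x = X (X x)" for x
    using cfc_mult[OF s s] by (simp add: X_def)
  then have "Re (cinner (cfc f A x) x) = (norm (X x))\<^sup>2" for x
    using self_adjointD[OF self_adjoint_cfc[OF s], folded X_def, of "X x" x]
    by (simp add: Re_cinner_self)
  then show ?thesis
    using self_adjoint_cfc[OF f] by (simp add: positive_op_def)
qed

end

lemma continuous_on_powr_nonneg: "0 < s \<Longrightarrow> continuous_on {0..} (\<lambda>t. t powr s :: real)"
  by (intro continuous_on_powr' continuous_intros) auto

text \<open>A vector killed by the power \<open>s\<close> is killed by the power
  \<open>s / 2\<close>, since the squared norm of its image is the form of the power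
  \<open>s\<close>. Repeated halving brings the exponent below 1, and multiplying by the
  complementary power gives \<open>A\<close> itself.\<close>

lemma cfc_powr_eq_0:
  fixes A :: "'a::chilbert_space \<Rightarrow> 'a"
  assumes A: "positive_op A" and "0 < s" and "cfc (\<lambda>t. t powr s) A x = 0"
  shows "A x = 0"
proof -
  define X where "X s = cfc (\<lambda>t. t powr s) A" for s
  have X_add: "X (s + t) x = X s (X t x)" if "0 < s" "0 < t" for s t x
    using cfc_mult[OF A continuous_on_powr_nonneg[OF that(1)] continuous_on_powr_nonneg[OF that(2)]]
    by (simp add: X_def powr_add)
  have half: "X (s / 2) x = 0" if "X s x = 0" "0 < s" for s
  proof -
    have "cinner (X (s / 2) x) (X (s / 2) x) = cinner (X (s / 2) (X (s / 2) x)) x"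
      using self_adjointD[OF self_adjoint_cfc[OF A continuous_on_powr_nonneg]] that by (simp add: X_def)
    also have "\<dots> = 0"
      using X_add[of "s / 2" "s / 2" x] that by simp
    finally show ?thesis
      by (simp add: cinner_eq_zero_iff)
  qed
  have halves: "X (s / 2 ^ n) x = 0" for n
  proof (induction n)
    case (Suc n)
    then show ?case
      using half[of "s / 2 ^ n"] \<open>0 < s\<close> by (simp add: mult.commute)
  qed (use assms in \<open>simp add: X_def\<close>)
  obtain n where "s < 2 ^ n"
    using real_arch_pow[of 2 s] by auto
  then have "0 < s / 2 ^ n" "s / 2 ^ n < 1"
    using \<open>0 < s\<close> by auto
  then have "X 1 x = X (1 - s / 2 ^ n) (X (s / 2 ^ n) x)"
    using X_add[of "1 - s / 2 ^ n" "s / 2 ^ n" x] by simp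
  also have "\<dots> = 0"
    using bounded_clinear_zero[OF bounded_clinear_cfc[OF A continuous_on_powr_nonneg]] \<open>s / 2 ^ n < 1\<close>
    by (simp add: halves) (simp add: X_def)
  finally show ?thesis
    using cfc_cong[OF A, of "\<lambda>t. t powr 1" "\<lambda>t. t"] by (simp add: X_def cfc_id[OF A])
qed

section \<open>Powers of the absolute value\<close>

context
  fixes A :: "'a::chilbert_space \<Rightarrow> 'a"
  assumes A: "bounded_clinear A"
begin

lemma positive_op_adjoint_compose: "positive_op (cadjoint A \<circ> A)"
proof -
  have *: "cinner ((cadjoint A \<circ> A) x) y = cinner (A x) (A y)" for x y
  proof -
    have "cinner (cadjoint A (A x)) y = cnj (cinner y (cadjoint A (A x)))"
      by (rule cinner_commute)
    also have "\<dots> = cinner (A x) (A y)"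
      unfolding cinner_cadjoint[OF A, symmetric] by (rule cinner_commute[symmetric])
    finally show ?thesis
      by simp
  qed
  have "cinner ((cadjoint A \<circ> A) x) y = cinner x ((cadjoint A \<circ> A) y)" for x y
    unfolding * by (simp only: comp_apply cinner_cadjoint[OF A])
  moreover have "0 \<le> Re (cinner ((cadjoint A \<circ> A) x) x)" for x
    unfolding * Re_cinner_self by simp
  moreover have "bounded_clinear (cadjoint A \<circ> A)"
    using bounded_clinear_compose[OF bounded_clinear_cadjoint[OF A] A] by (simp add: comp_def)
  ultimately show ?thesis
    by (simp add: positive_op_def self_adjoint_def)
qed

lemma positive_op_abs_op: "positive_op (abs_op A)"
  unfolding abs_op_def
  by (rule positive_op_cfc[OF positive_op_adjoint_compose]) (auto intro: continuous_intros)

text \<open>Both squared norms are the form of \<open>cadjoint A \<circ> A\<close>, the square of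
  \<open>abs_op A\<close>. In particular the two operators have the same kernel.\<close>

lemma norm_abs_op: "norm (abs_op A x) = norm (A x)"
proof -
  note P = positive_op_adjoint_compose
  have s: "continuous_on {0..} (\<lambda>t::real. sqrt t)"
    by (intro continuous_intros)
  have "cfc (\<lambda>t. sqrt t * sqrt t) (cadjoint A \<circ> A) = cfc (\<lambda>t. t) (cadjoint A \<circ> A)"
    by (rule cfc_cong[OF P]) simp
  then have "abs_op A (abs_op A x) = cadjoint A (A x)"
    using cfc_mult[OF P s s, of x] cfc_id[OF P] by (simp add: abs_op_def)
  then have "cinner (abs_op A x) (abs_op A x) = cinner (A x) (A x)"
    using self_adjointD[of "abs_op A" x "abs_op A x"] positive_op_abs_op cinner_cadjoint[OF A, of x "A x"]
    by (simp add: positive_op_def)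
  then have "(norm (abs_op A x))\<^sup>2 = (norm (A x))\<^sup>2"
    unfolding cinner_self of_real_eq_iff .
  then show ?thesis
    by simp
qed

lemma positive_op_abs_op_power: "0 < s \<Longrightarrow> positive_op (abs_op_power A s)"
  unfolding abs_op_power_def
  by (rule positive_op_cfc[OF positive_op_abs_op continuous_on_powr_nonneg]) auto

lemma abs_op_power_eq_0: "0 < s \<Longrightarrow> abs_op_power A s x = 0 \<Longrightarrow> A x = 0"
  using cfc_powr_eq_0[OF positive_op_abs_op, of s x] norm_abs_op[of x]
  by (simp add: abs_op_power_def)

end

section \<open>Absolute values of rank-one operators\<close>

lemma spectrum_idempotent_multiple:
  assumes K: "bounded_clinear K" and KK: "\<And>v. K (K v) = k *\<^sub>C K v"
  shows "spectrum K \<subseteq> {0, k}"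
proof -
  have "z \<notin> spectrum K" if "z \<noteq> 0" "z \<noteq> k" for z
  proof (rule not_in_spectrumI)
    \<comment> \<open>The resolvent in closed form: the Neumann series of \<open>K - z\<close>
      collapses to two terms because the square of \<open>K\<close> is \<open>k\<close> times
      \<open>K\<close>.\<close>
    define B where "B x = (- (1 / z)) *\<^sub>C (x + (1 / (z - k)) *\<^sub>C K x)" for x
    show "bounded_clinear B"
      unfolding B_def by (intro bounded_clinear_scaleC_op bounded_clinear_add bounded_clinear_id K)
    have B: "B x = (- (1 / z)) *\<^sub>C x - (1 / (z * (z - k))) *\<^sub>C K x" for x
      by (simp add: B_def scaleC_add_right)
    have eq: "(- (1 / z) - k / (z * (z - k))) *\<^sub>C K x + (1 / (z - k)) *\<^sub>C K x = 0" for x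
    proof -
      define w where "w = z - k"
      have "w \<noteq> 0"
        using that by (simp add: w_def)
      then have "- (1 / z) - k / (z * w) + 1 / w = 0"
        using that by (simp add: divide_simps) (simp add: w_def)
      then show ?thesis
        unfolding scaleC_add_left[symmetric] w_def by simp
    qed
    have "K (B x) - z *\<^sub>C B x
        = x + ((- (1 / z) - k / (z * (z - k))) *\<^sub>C K x + (1 / (z - k)) *\<^sub>C K x)" for x
      using that by (simp add: B bounded_clinear_apply[OF K] KK complex_vector.scale_left_diff_distrib
          complex_vector.scale_right_diff_distrib scaleC_add_left)
    then show "K (B x) - z *\<^sub>C B x = x" for x
      by (simp only: eq add_0_right)
    have "B (K x - z *\<^sub>C x)
        = x + ((- (1 / z) - k / (z * (z - k))) *\<^sub>C K x + (1 / (z - k)) *\<^sub>C K x)" for x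
      using that by (simp add: B bounded_clinear_apply[OF K] KK complex_vector.scale_left_diff_distrib
          complex_vector.scale_right_diff_distrib scaleC_add_left)
    then show "B (K x - z *\<^sub>C x) = x" for x
      by (simp only: eq add_0_right)
  qed
  then show ?thesis
    by blast
qed

lemma cadjoint_rank1: "cadjoint (rank1 u x) = rank1 x u"
proof (rule cadjoint_eqI)
  show "cinner (rank1 u x v) y = cinner v (rank1 x u y)" for v y
    using cinner_commute[of u y] by (simp add: rank1_def cinner_simps)
qed simp

text \<open>The spectrum has at most the points \<open>0\<close> and \<open>a\<close>, where a
  function vanishing at \<open>0\<close> agrees with a linear polynomial.\<close>

lemma cfc_scaled_projection:
  fixes x :: "'a::chilbert_space"
  assumes "norm x = 1" "0 \<le> a" "f 0 = 0"
  shows "cfc f (\<lambda>v. a *\<^sub>R rank1 x x v) = (\<lambda>v. f a *\<^sub>R rank1 x x v)"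
proof -
  define K where "K v = a *\<^sub>R rank1 x x v" for v
  have bK: "bounded_clinear K"
    unfolding K_def by (intro bounded_clinear_scaleR_op bounded_clinear_rank1)
  have saK: "self_adjoint K"
    using bK cinner_commute[of x]
    by (simp add: self_adjoint_def K_def rank1_def cinner_simps ac_simps)
  have "K (K v) = complex_of_real a *\<^sub>C K v" for v
    using \<open>norm x = 1\<close> by (simp add: K_def rank1_def cinner_simps cinner_self flip: scaleC_of_real)
  then have "spectrum K \<subseteq> {0, complex_of_real a}"
    by (rule spectrum_idempotent_multiple[OF bK])
  then have S: "real_spectrum K \<subseteq> {0, a}"
    by auto
  define p where "p = [:0, f a / a:]"
  \<comment> \<open>for \<open>a = 0\<close> both \<open>f a\<close> and the junk value \<open>f a / a\<close> vanish\<close>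
  have p: "poly p t = f t" if "t \<in> {0, a}" for t
    using that assms(3) by (auto simp: p_def)
  have X: "poly_op p K = (\<lambda>v. f a *\<^sub>R rank1 x x v)"
  proof
    fix v
    have "poly_op p K v = (f a / a) *\<^sub>R K v"
      by (simp add: p_def poly_op_pCons[OF bK] bounded_clinear_apply[OF bK])
    then show "poly_op p K v = f a *\<^sub>R rank1 x x v"
      using assms(3) by (simp add: K_def)
  qed
  have "uniform_limit (real_spectrum K) (\<lambda>n. poly p) f sequentially"
    using p S by (intro uniform_limitI) auto
  then have "cfc_lim f K (poly_op p K)"
    unfolding cfc_lim_def mem_bounded_ops
    by (intro conjI exI[of _ "\<lambda>n. p"]) (auto simp: onorm_zero bounded_clinear_poly_op[OF bK])
  then have "cfc f K = poly_op p K"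
    by (rule cfc_eqI[OF saK])
  then show ?thesis
    unfolding X by (simp add: K_def[abs_def])
qed

lemma abs_op_power_rank1:
  fixes x :: "'a::chilbert_space"
  assumes "norm x = 1" "0 < s"
  shows "abs_op_power (rank1 u x) s = (\<lambda>v. norm u powr s *\<^sub>R rank1 x x v)"
proof -
  have "cadjoint (rank1 u x) \<circ> rank1 u x = (\<lambda>v. (norm u)\<^sup>2 *\<^sub>R rank1 x x v)"
    unfolding cadjoint_rank1
    by (simp add: fun_eq_iff rank1_def cinner_simps cinner_self mult.commute flip: scaleC_of_real)
  then have "abs_op (rank1 u x) = (\<lambda>v. norm u *\<^sub>R rank1 x x v)"
    using cfc_scaled_projection[OF assms(1), of "(norm u)\<^sup>2" sqrt] by (simp add: abs_op_def)
  then show ?thesis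
    using cfc_scaled_projection[OF assms(1), of "norm u" "\<lambda>t. t powr s"] by (simp add: abs_op_power_def)
qed

section \<open>Operators of rank one\<close>

text \<open>The product maps into the line of \<open>x\<close>, so its square is a multiple
  \<open>k\<close> of itself, and \<open>x\<close> is an eigenvector when \<open>k\<close> is
  nonzero. The point \<open>0\<close> is removed since its membership may depend on the
  dimension.\<close>

lemma spectrum_rank1_comp:
  fixes x :: "'a::chilbert_space"
  assumes B: "bounded_clinear B"
  shows "spectrum ((\<lambda>v. a *\<^sub>R rank1 x x v) \<circ> B) - {0} = {of_real a * cinner (B x) x} - {0}"
proof -
  define k where "k = of_real a * cinner (B x) x"
  define K where "K = (\<lambda>v. a *\<^sub>R rank1 x x v) \<circ> B"
  have K: "K v = (of_real a * cinner (B v) x) *\<^sub>C x" for v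
    by (simp add: K_def rank1_def flip: scaleC_of_real)
  have "bounded_clinear K"
    unfolding K_def comp_def
    by (intro bounded_clinear_scaleR_op bounded_clinear_compose[OF bounded_clinear_rank1 B])
  moreover have "K (K v) = k *\<^sub>C K v" for v
    by (simp add: K k_def bounded_clinear_scaleC[OF B] cinner_simps ac_simps)
  ultimately have "spectrum K \<subseteq> {0, k}"
    by (rule spectrum_idempotent_multiple)
  moreover have "k \<in> spectrum K" if "k \<noteq> 0"
  proof (rule eigenvalue_in_spectrum)
    show "x \<noteq> 0"
      using that by (auto simp: k_def)
  qed (simp add: K k_def)
  ultimately show ?thesis
    unfolding K_def k_def by blast
qed

text \<open>For independent \<open>P u\<close> and \<open>P v\<close>, an operator \<open>B\<close>
  with \<open>B (P u) = u\<close> and \<open>B (P v) = 2 *\<^sub>C v\<close> would give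
  \<open>P \<circ> B\<close> the eigenvalues 1 and 2.\<close>

lemma range_in_line_if_spectra_small:
  fixes P :: "'a::chilbert_space \<Rightarrow> 'a"
  assumes P: "bounded_clinear P"
    and small: "\<And>B z w. bounded_clinear B \<Longrightarrow> z \<in> spectrum (P \<circ> B) - {0} \<Longrightarrow> w \<in> spectrum (P \<circ> B) - {0} \<Longrightarrow> z = w"
  shows "\<exists>c. P v = c *\<^sub>C P u \<or> P u = 0"
proof (rule ccontr)
  assume H: "\<nexists>c. P v = c *\<^sub>C P u \<or> P u = 0"
  define proj where "proj x y = (cinner x y / cinner y y) *\<^sub>C y" for x y :: 'a
  have orth: "cinner y (x - proj x y) = 0" for x y
  proof (cases "y = 0")
    case False
    then have "cinner (x - proj x y) y = 0"
      by (simp add: proj_def cinner_simps cinner_eq_zero_iff)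
    then show ?thesis
      using cinner_commute[of y "x - proj x y"] by simp
  qed simp
  have self: "cinner x (x - proj x y) = cinner (x - proj x y) (x - proj x y)" for x y
    using orth[of y x] by (simp add: proj_def cinner_diff_left[of x] cinner_scaleC_left)
  \<comment> \<open>Up to scaling, \<open>a\<close> and \<open>b\<close> are dual to
    \<open>P u\<close> and \<open>P v\<close>: each is the component of one vector orthogonal to the
    other.\<close>
  define a where "a = P u - proj (P u) (P v)"
  define b where "b = P v - proj (P v) (P u)"
  have "P u \<noteq> 0" "P v \<noteq> 0"
    using H by (auto intro: exI[of _ 0])
  have "b \<noteq> 0"
    using H by (auto simp: b_def proj_def)
  have "a \<noteq> 0"
  proof
    assume "a = 0"
    then obtain c where c: "P u = c *\<^sub>C P v"
      unfolding a_def proj_def by auto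
    then have "c \<noteq> 0"
      using \<open>P u \<noteq> 0\<close> by auto
    then have "P v = (1 / c) *\<^sub>C P u"
      by (simp add: c)
    then show False
      using H by blast
  qed
  have a: "cinner (P u) a \<noteq> 0" "cinner (P v) a = 0"
    using \<open>a \<noteq> 0\<close> orth self by (auto simp: a_def cinner_eq_zero_iff)
  have b: "cinner (P v) b \<noteq> 0" "cinner (P u) b = 0"
    using \<open>b \<noteq> 0\<close> orth self by (auto simp: b_def cinner_eq_zero_iff)
  define B where "B x = (1 / cinner (P u) a) *\<^sub>C rank1 u a x + (2 / cinner (P v) b) *\<^sub>C rank1 v b x" for x
  have B: "bounded_clinear B"
    unfolding B_def by (intro bounded_clinear_add bounded_clinear_scaleC_op bounded_clinear_rank1)
  have "1 \<in> spectrum (P \<circ> B)"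
    by (rule eigenvalue_in_spectrum[of _ "P u"])
      (use a b \<open>P u \<noteq> 0\<close> in \<open>simp_all add: B_def rank1_def bounded_clinear_apply[OF P]\<close>)
  moreover have "2 \<in> spectrum (P \<circ> B)"
    by (rule eigenvalue_in_spectrum[of _ "P v"])
      (use a b \<open>P v \<noteq> 0\<close> in \<open>simp_all add: B_def rank1_def bounded_clinear_apply[OF P]\<close>)
  ultimately show False
    using small[OF B, of 1 2] by simp
qed

text \<open>The power \<open>P\<close> of the absolute value has range in a line spanned by
  \<open>x\<close>. Being self-adjoint it vanishes on the orthogonal complement of \<open>x\<close>,
  and so does \<open>A\<close>, whose kernel contains that of \<open>P\<close>.\<close>

lemma rank1_if_spectra_small:
  fixes A :: "'a::chilbert_space \<Rightarrow> 'a"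
  assumes A: "bounded_clinear A" and "0 < s" and "norm (e::'a) = 1"
    and small: "\<And>B z w. bounded_clinear B \<Longrightarrow> z \<in> spectrum (abs_op_power A s \<circ> B) - {0} \<Longrightarrow>
      w \<in> spectrum (abs_op_power A s \<circ> B) - {0} \<Longrightarrow> z = w"
  shows "\<exists>u x. norm x = 1 \<and> A = rank1 u x"
proof -
  define P where "P = abs_op_power A s"
  have sP: "self_adjoint P"
    using positive_op_abs_op_power[OF A \<open>0 < s\<close>] by (simp add: P_def positive_op_def)
  note bP = self_adjoint_bounded_clinear[OF sP]
  obtain x where x: "norm x = 1" and line: "\<And>v. \<exists>c. P v = c *\<^sub>C x"
  proof (cases "\<forall>v. P v = 0")
    case True
    then show ?thesis
      \<comment> \<open>If \<open>P\<close> vanishes, any unit vector can serve as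
        \<open>x\<close>.\<close>
      using that[OF \<open>norm e = 1\<close>] by (metis complex_vector.scale_zero_left)
  next
    case False
    then obtain u where u: "P u \<noteq> 0"
      by blast
    then obtain x where x: "norm x = 1" "P u = complex_of_real (norm (P u)) *\<^sub>C x"
      by (rule normalize_scaleC)
    have "\<exists>c. P v = c *\<^sub>C x" for v
    proof -
      have "\<exists>c. P v = c *\<^sub>C P u \<or> P u = 0"
        using small[folded P_def] by (rule range_in_line_if_spectra_small[OF bP])
      then obtain c where "P v = c *\<^sub>C P u"
        using u by blast
      then show ?thesis
        using x(2) by (metis scaleC_scaleC)
    qed
    then show ?thesis
      using that x(1) by blast
  qed
  have kernel: "A v = 0" if "cinner v x = 0" for v
  proof -
    obtain c where "P (P v) = c *\<^sub>C x"
      using line by blast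
    then have "cinner (P v) (P v) = 0"
      using that self_adjointD[OF sP, of v "P v"] by (simp add: cinner_simps)
    then show ?thesis
      using abs_op_power_eq_0[OF A \<open>0 < s\<close>] by (simp add: P_def cinner_eq_zero_iff)
  qed
  have "A v = rank1 (A x) x v" for v
    using kernel[of "v - cinner v x *\<^sub>C x"] x
    by (simp add: cinner_simps cinner_self rank1_def bounded_clinear_apply[OF A])
  then show ?thesis
    using x by blast
qed

section \<open>Spectrum preserving maps\<close>

text \<open>For \<open>v\<close> orthogonal to \<open>e\<close>, the vectors \<open>v + e\<close>,
  \<open>v - e\<close> and \<open>e\<close> are all admissible, and the parallelogram identity for
  the form of \<open>D\<close> transfers its vanishing to \<open>v\<close>.\<close>

lemma op_eq_if_cinner_eq_dense:
  assumes A: "bounded_clinear A" and B: "bounded_clinear B" and "e \<noteq> 0"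
    and q: "\<And>v. norm v = 1 \<Longrightarrow> cinner v e \<noteq> 0 \<Longrightarrow> cinner (A v) v = cinner (B v) v"
  shows "A = B"
proof
  define D where "D x = A x - B x" for x
  have D: "bounded_clinear D"
    unfolding D_def by (intro bounded_clinear_diff A B)
  have D0: "cinner (D v) v = 0" if "cinner v e \<noteq> 0" for v
  proof -
    have "v \<noteq> 0"
      using that by auto
    then obtain v' where v': "norm v' = 1" "v = complex_of_real (norm v) *\<^sub>C v'"
      by (rule normalize_scaleC)
    then have "cinner v' e \<noteq> 0"
      using that by (metis cinner_scaleC_left mult_zero_right)
    then have "cinner (D v') v' = 0"
      using q[OF v'(1)] by (simp add: D_def cinner_diff_left)
    then show ?thesis
      by (subst (1 2) v'(2)) (simp add: bounded_clinear_scaleC[OF D] cinner_simps)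
  qed
  have "cinner (D v) v = 0" for v
  proof (cases "cinner v e = 0")
    case True
    have "cinner (D (v + e)) (v + e) = 0" "cinner (D (v - e)) (v - e) = 0" "cinner (D e) e = 0"
      using True \<open>e \<noteq> 0\<close> by (intro D0; simp add: cinner_simps cinner_eq_zero_iff)+
    then show ?thesis
      by (simp add: bounded_clinear_apply[OF D] cinner_simps add_eq_0_iff)
  qed (rule D0)
  then show "A v = B v" for v
    using op_eq_zero_if_cinner_zero[OF D, of v] by (simp add: D_def)
qed

lemma cadjoint_isometry:
  assumes T: "bounded_clinear T" and "\<And>x. norm (T x) = norm x"
  shows "cadjoint T (T x) = x"
proof -
  have "(\<lambda>x. cadjoint T (T x)) = (\<lambda>x. x)"
  proof (rule op_eq_if_cinner_eq)
    show "bounded_clinear (\<lambda>x. cadjoint T (T x))"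
      by (rule bounded_clinear_compose[OF bounded_clinear_cadjoint[OF T] T])
    show "cinner (cadjoint T (T x)) x = cinner x x" for x
      using cinner_cadjoint[OF T, of x "T x"] cinner_commute[of x "cadjoint T (T x)"] assms(2)
      by (simp add: cinner_self) (metis complex_cnj_complex_of_real complex_cnj_power cinner_commute)
  qed simp
  then show ?thesis
    by metis
qed

text \<open>The orthogonal part \<open>w'\<close> of \<open>w\<close> is detected by the test vector
  \<open>y + \<i> *\<^sub>C w'\<close>, at which the form has imaginary part minus the squared norm
  of \<open>w'\<close>.\<close>

lemma positive_rank1:
  fixes w y :: "'a::complex_inner"
  assumes "norm y = 1"
    and real: "\<And>z. Im (cinner (rank1 w y z) z) = 0" and pos: "\<And>z. 0 \<le> Re (cinner (rank1 w y z) z)"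
  shows "w = complex_of_real (norm w) *\<^sub>C y"
proof -
  define c where "c = cinner w y"
  have yy: "cinner y y = 1"
    using \<open>norm y = 1\<close> by (simp add: cinner_self)
  have c: "Im c = 0" "0 \<le> Re c"
    using real[of y] pos[of y] by (simp_all add: rank1_def cinner_simps yy c_def)
  define w' where "w' = w - c *\<^sub>C y"
  have w'y: "cinner w' y = 0" "cinner y w' = 0"
    using yy cinner_commute[of y w'] by (simp_all add: w'_def cinner_simps c_def)
  then have "cinner w w' = cinner w' w'"
    using cinner_add_left[of w' "c *\<^sub>C y" w'] by (simp add: w'_def cinner_scaleC_left)
  then have "Im (cinner w (y + \<i> *\<^sub>C w')) = - (norm w')\<^sup>2"
    using c by (simp add: cinner_simps cinner_self flip: c_def)
  moreover have "cinner (y + \<i> *\<^sub>C w') y = 1"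
    using w'y by (simp add: cinner_simps yy)
  ultimately have "w' = 0"
    using real[of "y + \<i> *\<^sub>C w'"] by (simp add: rank1_def cinner_scaleC_left)
  moreover have "c = complex_of_real (Re c)"
    using c(1) by (simp add: complex_eq_iff)
  ultimately have w: "w = complex_of_real (Re c) *\<^sub>C y"
    by (simp add: w'_def)
  then have "norm w = Re c"
    using c(2) \<open>norm y = 1\<close> by (metis abs_of_nonneg mult.right_neutral norm_of_real norm_scaleC)
  then show ?thesis
    using w by simp
qed

section \<open>Quadratic forms under a spectrum preserving map\<close>

context
  fixes \<phi> :: "('a::chilbert_space \<Rightarrow> 'a) \<Rightarrow> ('a \<Rightarrow> 'a)" and s :: real and e :: 'a
  assumes s: "0 < s" and e: "norm e = 1"
    and range_phi: "\<phi> ` bounded_ops = bounded_ops"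
    and spectrum_phi: "\<And>A B. bounded_clinear A \<Longrightarrow> bounded_clinear B \<Longrightarrow>
      spectrum (abs_op_power A s \<circ> B) = spectrum (abs_op_power (\<phi> A) s \<circ> \<phi> B)"
begin

lemma bounded_clinear_phi: "bounded_clinear A \<Longrightarrow> bounded_clinear (\<phi> A)"
  using range_phi by (metis image_eqI mem_bounded_ops)

lemma phi_surjE:
  assumes "bounded_clinear C"
  obtains A where "bounded_clinear A" "\<phi> A = C"
  using range_phi assms by (metis imageE mem_bounded_ops)

lemma cinner_phi_if_rank1:
  assumes "\<phi> (rank1 u x) = rank1 w y" "norm x = 1" "norm y = 1" "bounded_clinear B"
  shows "norm u powr s * cinner (B x) x = norm w powr s * cinner (\<phi> B y) y"
proof -
  have "{norm u powr s * cinner (B x) x} - {0} = spectrum (abs_op_power (rank1 u x) s \<circ> B) - {0}"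
    using abs_op_power_rank1[OF assms(2) s] spectrum_rank1_comp[OF assms(4)] by simp
  also have "\<dots> = spectrum (abs_op_power (rank1 w y) s \<circ> \<phi> B) - {0}"
    using spectrum_phi[OF bounded_clinear_rank1 assms(4)] assms(1) by simp
  also have "\<dots> = {norm w powr s * cinner (\<phi> B y) y} - {0}"
    using abs_op_power_rank1[OF assms(3) s] spectrum_rank1_comp[OF bounded_clinear_phi[OF assms(4)]]
    by simp
  \<comment> \<open>Singletons that agree away from \<open>0\<close> have equal elements: if the
    difference is empty, both elements are \<open>0\<close>.\<close>
  finally show ?thesis
    by (metis Diff_iff insert_iff singletonD)
qed

text \<open>By surjectivity every test operator is some \<open>\<phi> B\<close>, so smallness of
  spectra passes from the rank-one operator to its image.\<close>

lemma phi_rank1: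
  assumes x: "norm x = 1"
  obtains w y where "norm y = 1" "\<phi> (rank1 u x) = rank1 w y"
proof -
  have "\<exists>w y. norm y = 1 \<and> \<phi> (rank1 u x) = rank1 w y"
  proof (rule rank1_if_spectra_small[OF bounded_clinear_phi[OF bounded_clinear_rank1] s e])
    fix C z w
    assume C: "bounded_clinear C" and z: "z \<in> spectrum (abs_op_power (\<phi> (rank1 u x)) s \<circ> C) - {0}"
      and w: "w \<in> spectrum (abs_op_power (\<phi> (rank1 u x)) s \<circ> C) - {0}"
    obtain B where B: "bounded_clinear B" "\<phi> B = C"
      using C by (rule phi_surjE)
    show "z = w"
      using z w spectrum_rank1_comp[OF B(1), of "norm u powr s" x]
      unfolding B(2)[symmetric] spectrum_phi[OF bounded_clinear_rank1 B(1), symmetric]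
        abs_op_power_rank1[OF x s] by auto
  qed
  then show ?thesis
    using that by blast
qed

lemma phi_rank1_inv:
  assumes y: "norm y = 1"
  obtains u x where "norm x = 1" "\<phi> (rank1 u x) = rank1 w y"
proof -
  obtain A where A: "bounded_clinear A" "\<phi> A = rank1 w y"
    using phi_surjE[OF bounded_clinear_rank1] .
  have "\<exists>u x. norm x = 1 \<and> A = rank1 u x"
  proof (rule rank1_if_spectra_small[OF A(1) s e])
    fix B z z'
    assume B: "bounded_clinear B" and z: "z \<in> spectrum (abs_op_power A s \<circ> B) - {0}"
      "z' \<in> spectrum (abs_op_power A s \<circ> B) - {0}"
    show "z = z'"
      using z spectrum_rank1_comp[OF bounded_clinear_phi[OF B], of "norm w powr s" y]
      unfolding spectrum_phi[OF A(1) B] A(2) abs_op_power_rank1[OF y s] by auto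
  qed
  then show ?thesis
    using that A(2) by blast
qed

lemma cinner_phi_scaled:
  assumes y: "norm y = 1"
  obtains x \<beta> where "norm x = 1" "0 < \<beta>"
    "\<And>B. bounded_clinear B \<Longrightarrow> cinner (\<phi> B y) y = complex_of_real \<beta> * cinner (B x) x"
proof -
  obtain u x where x: "norm x = 1" and phi: "\<phi> (rank1 u x) = rank1 y y"
    using phi_rank1_inv[OF y] .
  have eq: "cinner (\<phi> B y) y = norm u powr s * cinner (B x) x" if "bounded_clinear B" for B
    using cinner_phi_if_rank1[OF phi x y that] y by simp
  obtain I where I: "bounded_clinear I" "\<phi> I = (\<lambda>x. x)"
    using phi_surjE[OF bounded_clinear_id] .
  \<comment> \<open>The preimage \<open>I\<close> of the identity has nonzero form at
    \<open>y\<close>, so the factor cannot vanish.\<close>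
  have "norm u powr s \<noteq> 0"
    using eq[OF I(1)] I(2) y by (auto simp: cinner_self)
  then have "0 < norm u powr s"
    by simp
  then show ?thesis
    using that x eq by blast
qed

text \<open>An operator is determined by its form, and each value of the form of
  \<open>\<phi> A\<close> is a fixed multiple of a value of the form of \<open>A\<close>. Linear
  relations between operators therefore survive \<open>\<phi>\<close>.\<close>

lemma phi_eqI:
  assumes C: "bounded_clinear C" and A: "bounded_clinear A"
    and q: "\<And>x y \<beta>. norm y = 1 \<Longrightarrow>
      (\<And>B. bounded_clinear B \<Longrightarrow> cinner (\<phi> B y) y = complex_of_real \<beta> * cinner (B x) x) \<Longrightarrow>
      cinner (C y) y = complex_of_real \<beta> * cinner (A x) x"
  shows "\<phi> A = C"
proof (rule op_eq_if_cinner_eq[OF bounded_clinear_phi[OF A] C])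
  fix y :: 'a assume y: "norm y = 1"
  then obtain x \<beta> where "\<And>B. bounded_clinear B \<Longrightarrow> cinner (\<phi> B y) y = complex_of_real \<beta> * cinner (B x) x"
    by (rule cinner_phi_scaled) blast
  then show "cinner (\<phi> A y) y = cinner (C y) y"
    using q[OF y] A by metis
qed

lemma phi_add:
  assumes "bounded_clinear A" "bounded_clinear B"
  shows "\<phi> (\<lambda>x. A x + B x) = (\<lambda>x. \<phi> A x + \<phi> B x)"
  by (rule phi_eqI) (use assms in \<open>auto simp: bounded_clinear_add bounded_clinear_phi cinner_simps distrib_left\<close>)

lemma phi_scaleC:
  assumes "bounded_clinear A"
  shows "\<phi> (\<lambda>x. c *\<^sub>C A x) = (\<lambda>x. c *\<^sub>C \<phi> A x)"
  by (rule phi_eqI) (use assms in \<open>auto simp: bounded_clinear_scaleC_op bounded_clinear_phi cinner_simps\<close>)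

lemma phi_projection:
  assumes x: "norm x = 1"
  obtains y where "norm y = 1" "\<phi> (rank1 x x) = rank1 y y"
    "\<And>B. bounded_clinear B \<Longrightarrow> cinner (\<phi> B y) y = cinner (B x) x"
proof -
  obtain w y where y: "norm y = 1" and phi: "\<phi> (rank1 x x) = rank1 w y"
    using phi_rank1[OF x] .
  have rel: "cinner (B x) x = norm w powr s * cinner (\<phi> B y) y" if "bounded_clinear B" for B
    using cinner_phi_if_rank1[OF phi x y that] x by simp
  \<comment> \<open>Every value of this form is a positive multiple of a value of the form of
    \<open>x \<otimes> x\<close>, hence nonnegative.\<close>
  have form: "\<exists>t\<ge>0. cinner (rank1 w y z) z = complex_of_real t" for z
  proof (cases "z = 0")
    case False
    then obtain z' where z': "norm z' = 1" "z = complex_of_real (norm z) *\<^sub>C z'"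
      by (rule normalize_scaleC)
    obtain x' \<beta> where "0 < \<beta>" and "\<And>B. bounded_clinear B \<Longrightarrow> cinner (\<phi> B z') z' = complex_of_real \<beta> * cinner (B x') x'"
      using cinner_phi_scaled[OF z'(1)] by blast
    then have "cinner (rank1 w y z') z' = complex_of_real \<beta> * cinner (rank1 x x x') x'"
      unfolding phi[symmetric] by simp
    moreover have "cinner (rank1 x x x') x' = complex_of_real ((cmod (cinner x' x))\<^sup>2)"
      unfolding complex_norm_square using cinner_commute[of x x']
      by (simp add: rank1_def cinner_scaleC_left)
    ultimately have "cinner (rank1 w y z') z' = complex_of_real (\<beta> * (cmod (cinner x' x))\<^sup>2)"
      by simp
    then have "cinner (rank1 w y z) z = complex_of_real ((norm z)\<^sup>2 * (\<beta> * (cmod (cinner x' x))\<^sup>2))"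
      by (subst (1 2) z'(2))
        (simp add: bounded_clinear_scaleC[OF bounded_clinear_rank1] cinner_simps power2_eq_square)
    then show ?thesis
      using \<open>0 < \<beta>\<close> by (intro exI[of _ "(norm z)\<^sup>2 * (\<beta> * (cmod (cinner x' x))\<^sup>2)"]) simp
  qed auto
  have w: "w = complex_of_real (norm w) *\<^sub>C y"
    by (rule positive_rank1[OF y]) (metis form Im_complex_of_real Re_complex_of_real)+
  \<comment> \<open>Testing \<open>rel\<close> on the operator \<open>rank1 x x\<close> itself
    produces the extra factor \<open>norm w\<close>; as \<open>s + 1\<close> is positive, only norm
    one is possible.\<close>
  have "complex_of_real 1 = complex_of_real (norm w powr s * norm w)"
  proof -
    have xx: "cinner (rank1 x x x) x = 1"
      using x by (simp add: rank1_def cinner_self)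
    have "cinner (rank1 w y y) y = cinner w y"
      using y by (simp add: rank1_def cinner_self)
    also have "\<dots> = complex_of_real (norm w)"
      using w y by (metis cinner_scaleC_left cinner_self mult.right_neutral of_real_1 power_one)
    finally show ?thesis
      using rel[OF bounded_clinear_rank1[of x x]] xx unfolding phi by simp
  qed
  then have one: "norm w powr s * norm w = 1"
    using of_real_eq_iff by metis
  then have "0 < norm w"
    by (metis mult_zero_right norm_ge_zero order_le_less zero_neq_one)
  then have "(s + 1) * ln (norm w) = 0"
    using arg_cong[OF one, of ln] by (simp add: ln_mult ln_powr algebra_simps)
  then have "norm w = 1"
    using s \<open>0 < norm w\<close> by simp
  then have "w = y"
    using w by simp
  then show ?thesis
    using that[OF y] phi rel \<open>norm w = 1\<close> by simp
qed

text \<open>Passing from \<open>y\<close> to \<open>x\<close> and on to \<open>y'\<close> compares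
  two forms of the same image; evaluating at the preimage of the identity forces the factor
  \<open>\<beta>\<close> to be 1.\<close>

lemma cinner_phi_id:
  assumes y: "norm y = 1"
  shows "cinner (\<phi> (\<lambda>x. x) y) y = 1"
proof -
  obtain x \<beta> where x: "norm x = 1"
    and xy: "\<And>B. bounded_clinear B \<Longrightarrow> cinner (\<phi> B y) y = complex_of_real \<beta> * cinner (B x) x"
    using cinner_phi_scaled[OF y] by blast
  obtain y' where y': "norm y' = 1" and "\<And>B. bounded_clinear B \<Longrightarrow> cinner (\<phi> B y') y' = cinner (B x) x"
    using phi_projection[OF x] by blast
  then have eq: "cinner (\<phi> B y) y = complex_of_real \<beta> * cinner (\<phi> B y') y'" if "bounded_clinear B" for B
    using xy that by simp
  obtain I where "bounded_clinear I" "\<phi> I = (\<lambda>x. x)"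
    using phi_surjE[OF bounded_clinear_id] .
  then have "\<beta> = 1"
    using eq[of I] y y' by (simp add: cinner_self)
  then show ?thesis
    using xy[OF bounded_clinear_id] x by (simp add: cinner_self)
qed

text \<open>Testing with the identity equates the powers of the two norms, after which this common
  factor cancels for nonzero \<open>u\<close>.\<close>

lemma phi_rank1_norm:
  assumes phi: "\<phi> (rank1 u x) = rank1 w y" and x: "norm x = 1" and y: "norm y = 1"
  shows "norm w = norm u"
    and "u \<noteq> 0 \<Longrightarrow> bounded_clinear B \<Longrightarrow> cinner (\<phi> B y) y = cinner (B x) x"
proof -
  note eq = cinner_phi_if_rank1[OF phi x y]
  have "complex_of_real (norm u powr s) = complex_of_real (norm w powr s)"
    using eq[OF bounded_clinear_id] cinner_phi_id[OF y] x by (simp add: cinner_self)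
  then have powr: "norm u powr s = norm w powr s"
    using of_real_eq_iff by blast
  then have "(norm w powr s) powr (1 / s) = (norm u powr s) powr (1 / s)"
    by simp
  then show "norm w = norm u"
    using s by (simp add: powr_powr)
  show "cinner (\<phi> B y) y = cinner (B x) x" if "u \<noteq> 0" "bounded_clinear B"
    using eq[OF that(2)] that(1) unfolding powr[symmetric] by simp
qed

section \<open>Construction of the implementing unitary\<close>

lemma phi_eq_conjugation:
  obtains T where "bounded_clinear T" "\<And>x. norm (T x) = norm x" "surj T"
    "\<And>B. bounded_clinear B \<Longrightarrow> \<phi> B = T \<circ> B \<circ> cadjoint T"
proof -
  obtain f where f: "norm f = 1" and phi_e: "\<phi> (rank1 e e) = rank1 f f"
    and form_f: "\<And>B. bounded_clinear B \<Longrightarrow> cinner (\<phi> B f) f = cinner (B e) e"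
    using phi_projection[OF e] by blast
  have parallel: "y = cinner y z *\<^sub>C z"
    if "norm y = 1" "norm z = 1" "cinner (rank1 z z y) y = 1" for y z :: 'a
  proof (rule scaleC_unit_if_cinner_eq_1[OF that(1,2)])
    have "complex_of_real ((cmod (cinner y z))\<^sup>2) = complex_of_real 1"
      using that(3) cinner_commute[of z y] unfolding complex_norm_square
      by (simp add: rank1_def cinner_scaleC_left)
    then have "(cmod (cinner y z))\<^sup>2 = 1"
      using of_real_eq_iff by blast
    then show "cmod (cinner y z) = 1"
      using power2_eq_iff_nonneg[of "cmod (cinner y z)" 1] by simp
  qed
  have shift: "rank1 w (k *\<^sub>C z) = rank1 (cnj k *\<^sub>C w) z" for w z :: 'a and k
    by (simp add: rank1_def fun_eq_iff cinner_scaleC_right mult.commute)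
  \<comment> \<open>Evaluation at \<open>f\<close> extracts the first leg of
    \<open>\<phi> (rank1 u e)\<close> once its second leg is known to be \<open>f\<close>.\<close>
  define T where "T u = \<phi> (rank1 u e) f" for u
  have T_eqI: "T u = w" if "\<phi> (rank1 u e) = rank1 w f" for u w
    using that f by (simp add: T_def rank1_def cinner_self)
  have phi_T: "\<phi> (rank1 u e) = rank1 (T u) f" and norm_T: "norm (T u) = norm u" for u
  proof -
    obtain w y where y: "norm y = 1" and phi: "\<phi> (rank1 u e) = rank1 w y"
      using phi_rank1[OF e] .
    have w: "norm w = norm u"
      using phi_rank1_norm(1)[OF phi e y] .
    have "\<exists>w'. \<phi> (rank1 u e) = rank1 w' f \<and> norm w' = norm u"
    proof (cases "u = 0")
      case True
      then show ?thesis
        using phi w by (intro exI[of _ 0]) (simp add: rank1_def)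
    next
      case False
      \<comment> \<open>Testing with \<open>rank1 e e\<close>, whose image is
        \<open>rank1 f f\<close>, shows that \<open>y\<close> is a unimodular multiple of
        \<open>f\<close>; the phase moves to the first leg.\<close>
      have "cinner (rank1 f f y) y = 1"
        using phi_rank1_norm(2)[OF phi e y False, of "rank1 e e"] e
        by (simp add: phi_e) (simp add: rank1_def cinner_self)
      then have y': "y = cinner y f *\<^sub>C f"
        by (rule parallel[OF y f])
      then have "\<phi> (rank1 u e) = rank1 (cnj (cinner y f) *\<^sub>C w) f"
        using phi shift by metis
      moreover have "cmod (cinner y f) = 1"
        using arg_cong[OF y', of norm] y f by simp
      ultimately show ?thesis
        using w by (intro exI[of _ "cnj (cinner y f) *\<^sub>C w"]) simp
    qed
    then show "\<phi> (rank1 u e) = rank1 (T u) f" "norm (T u) = norm u"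
      using T_eqI by auto
  qed
  have T: "bounded_clinear T"
  proof (rule bounded_clinearI)
    have "rank1 (u + v) e = (\<lambda>x. rank1 u e x + rank1 v e x)" for u v
      by (simp add: rank1_def scaleC_add_right)
    then show "T (u + v) = T u + T v" for u v
      by (simp add: T_def phi_add)
    have "rank1 (c *\<^sub>C u) e = (\<lambda>x. c *\<^sub>C rank1 u e x)" for c u
      by (simp add: rank1_def mult.commute)
    then show "T (c *\<^sub>C u) = c *\<^sub>C T u" for c u
      by (simp add: T_def phi_scaleC)
    show "norm (T u) \<le> norm u * 1" for u
      by (simp add: norm_T)
  qed
  have surj_T: "\<exists>u. T u = w" for w
  proof (cases "w = 0")
    case True
    then show ?thesis
      using bounded_clinear_zero[OF T] by blast
  next
    case False
    \<comment> \<open>Pull \<open>rank1 w f\<close> back and test again with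
      \<open>rank1 e e\<close>: now \<open>x\<close> must be a multiple of \<open>e\<close>, and
      \<open>u\<close> with the adjusted phase is the preimage.\<close>
    obtain u x where x: "norm x = 1" and phi: "\<phi> (rank1 u x) = rank1 w f"
      using phi_rank1_inv[OF f] .
    have "u \<noteq> 0"
      using phi_rank1_norm(1)[OF phi x f] False by auto
    then have "cinner (rank1 e e x) x = 1"
      using phi_rank1_norm(2)[OF phi x f, of "rank1 e e"] form_f[of "rank1 e e"] e
      by simp (simp add: rank1_def cinner_self)
    then have "x = cinner x e *\<^sub>C e"
      by (rule parallel[OF x e])
    then have "\<phi> (rank1 (cnj (cinner x e) *\<^sub>C u) e) = rank1 w f"
      using phi shift by metis
    then show ?thesis
      using T_eqI by blast
  qed
  note T'T = cadjoint_isometry[OF T norm_T]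
  have TT': "T (cadjoint T y) = y" for y
    using surj_T[of y] T'T by metis
  have cinner_T: "cinner (T u) y = cinner u (cadjoint T y)" for u y
    by (rule cinner_cadjoint[OF T])
  have form: "cinner (\<phi> B (T v)) (T v) = cinner (B v) v"
    if v: "norm v = 1" "cinner v e \<noteq> 0" and B: "bounded_clinear B" for v B
  proof -
    obtain y where y: "norm y = 1"
      and form_y: "\<And>B. bounded_clinear B \<Longrightarrow> cinner (\<phi> B y) y = cinner (B v) v"
      using phi_projection[OF v(1)] by blast
    define z where "z = cadjoint T y"
    \<comment> \<open>Equating the forms of \<open>rank1 u e\<close> at \<open>v\<close> and of its
      image at \<open>y\<close> for every \<open>u\<close> identifies the two vectors. Division by
      the nonzero \<open>cinner v e\<close> makes \<open>v\<close> a multiple of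
      \<open>z\<close>.\<close>
    have "cnj (cinner v e) *\<^sub>C v = cnj (cinner y f) *\<^sub>C z"
    proof (rule cinner_ext)
      fix u
      have "cinner v e * cinner u v = cinner y f * cinner (T u) y"
        using form_y[OF bounded_clinear_rank1[of u e]] unfolding phi_T
        by (simp add: rank1_def cinner_scaleC_left)
      then show "cinner u (cnj (cinner v e) *\<^sub>C v) = cinner u (cnj (cinner y f) *\<^sub>C z)"
        by (simp add: cinner_scaleC_right cinner_T z_def)
    qed
    then have "(1 / cnj (cinner v e)) *\<^sub>C cnj (cinner v e) *\<^sub>C v
        = (1 / cnj (cinner v e)) *\<^sub>C cnj (cinner y f) *\<^sub>C z"
      by (rule arg_cong)
    then obtain k where k: "v = k *\<^sub>C z"
      using v(2) by auto
    have Tv: "T v = k *\<^sub>C y"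
      using TT' by (simp add: k z_def bounded_clinear_scaleC[OF T])
    then have "cmod k = 1"
      using norm_T[of v] v(1) y by simp
    \<comment> \<open>A phase does not change a quadratic form, so \<open>T v\<close> may replace
      \<open>y\<close>.\<close>
    then have "cnj k * k = 1"
      using complex_norm_square[of k] by (simp add: mult.commute)
    then have "cinner (\<phi> B (T v)) (T v) = cinner (\<phi> B y) y"
      by (simp add: Tv bounded_clinear_scaleC[OF bounded_clinear_phi[OF B]] cinner_simps flip: mult.assoc)
    then show ?thesis
      using form_y[OF B] by simp
  qed
  have "\<phi> B = T \<circ> B \<circ> cadjoint T" if B: "bounded_clinear B" for B
  proof
    fix y
    have T': "bounded_clinear (cadjoint T)"
      using T by (rule bounded_clinear_cadjoint)
    \<comment> \<open>The forms of the two sides are known to agree only off the hyperplane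
      orthogonal to \<open>e\<close>, which still determines the operator.\<close>
    have "(\<lambda>x. cadjoint T (\<phi> B (T x))) = B"
    proof (rule op_eq_if_cinner_eq_dense)
      show "bounded_clinear (\<lambda>x. cadjoint T (\<phi> B (T x)))"
        by (rule bounded_clinear_compose[OF T' bounded_clinear_compose[OF bounded_clinear_phi[OF B] T]])
      show "cinner (cadjoint T (\<phi> B (T v))) v = cinner (B v) v" if "norm v = 1" "cinner v e \<noteq> 0" for v
      proof -
        have "cinner (cadjoint T (\<phi> B (T v))) v = cinner (T (cadjoint T (\<phi> B (T v)))) (T v)"
          by (simp add: cinner_T T'T)
        then show ?thesis
          using form[OF that B] by (simp add: TT')
      qed
      show "e \<noteq> 0"
        using e by auto
    qed (rule B)
    then have "B (cadjoint T y) = cadjoint T (\<phi> B (T (cadjoint T y)))"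
      by metis
    then show "\<phi> B y = (T \<circ> B \<circ> cadjoint T) y"
      by (simp add: TT')
  qed
  then show ?thesis
    using that[OF T norm_T] surj_T by (metis surj_def)
qed

end

theorem theorem1p3:
  fixes \<phi> :: "('a::chilbert_space \<Rightarrow> 'a) \<Rightarrow> ('a \<Rightarrow> 'a)"
    and r :: rat
  assumes "0 < r" and "1 < r"
    and "\<phi> ` bounded_ops = bounded_ops"
    and "\<forall>A\<in>bounded_ops. \<forall>B\<in>bounded_ops.
           spectrum (abs_op_power A (of_rat r) \<circ> B)
             = spectrum (abs_op_power (\<phi> A) (of_rat r) \<circ> \<phi> B)"
  shows "\<exists>T. bij T \<and>
           (bounded_clinear T \<and> cadjoint T = inv T \<and>
              (\<forall>A\<in>bounded_ops. \<phi> A = T \<circ> A \<circ> cadjoint T)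
            \<or> bounded_antilinear T \<and> antilinear_adjoint T = inv T \<and>
              (\<forall>A\<in>bounded_ops. \<phi> A = T \<circ> A \<circ> antilinear_adjoint T))"
proof (cases "\<exists>x::'a. x \<noteq> 0")
  case False
  \<comment> \<open>On the zero space all maps coincide, so the identity is a witness.\<close>
  then have eq: "F = G" for F G :: "'a \<Rightarrow> 'a"
    by (intro ext) metis
  have "bounded_clinear (\<lambda>x::'a. x)" "bij (\<lambda>x::'a. x)"
    by (simp_all add: bij_def inj_def surj_def)
  then show ?thesis
    using eq by (intro exI[of _ "\<lambda>x. x"]) blast
next
  case True
  then obtain e :: 'a where e: "norm e = 1"
    using normalize_scaleC by blast
  have s: "0 < (of_rat r :: real)"
    using \<open>0 < r\<close> by simp
  have spec: "spectrum (abs_op_power A (of_rat r) \<circ> B) = spectrum (abs_op_power (\<phi> A) (of_rat r) \<circ> \<phi> B)"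
    if "bounded_clinear A" "bounded_clinear B" for A B
    using assms(4) that by (simp add: mem_bounded_ops)
  obtain T where T: "bounded_clinear T" and norm_T: "\<And>x. norm (T x) = norm x" and "surj T"
    and phi: "\<And>B. bounded_clinear B \<Longrightarrow> \<phi> B = T \<circ> B \<circ> cadjoint T"
    using phi_eq_conjugation[OF s e assms(3) spec] by blast
  have T'T: "cadjoint T (T x) = x" for x
    by (rule cadjoint_isometry[OF T norm_T])
  then have "bij T"
    using \<open>surj T\<close> by (metis bijI injI)
  moreover have "cadjoint T = inv T"
    using T'T \<open>bij T\<close> by (metis bij_betw_imp_surj_on ext inv_f_eq bij_is_inj surj_f_inv_f)
  ultimately show ?thesis
    using T phi by (auto simp: mem_bounded_ops)
qed

end
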